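(* Consider the interconnected system $\dot x_i=f_i(t,x_1,\dots,x_m)$, $t\ge t_0$, $i\in\{1,\dots,m\}$, $m\ge2$, with $x_i\in\mathbb{R}^{n_i}$, $n_1+\cdots+n_m=n$, and let $K\subset\mathbb{R}^n$ be a compact set with nonempty interior. Let $A_{\mathrm N}(t,x)=[a_{ij}(t,x)]\in\mathbb{R}^{m\times m}$ be the interconnection matrix function $$a_{ii}(t,x):=\mu_i\big(J_{x_i}f_i(t,x)\big),\qquad a_{ij}(t,x):=\big\|J_{x_j}f_i(t,x)\big\|_{ij}\quad(i\ne j).$$ Then the topological entropy of the interconnected system satisfies $$h(f,t_0,K)\le n\max\{\hat\mu_{\mathrm N},\,0\},\qquad \hat\mu_{\mathrm N}:=\limsup_{t\to\infty}\ \max_{v\in\operatorname{co}(\xi(t,t_0,K))}\mu_{\mathrm N}\big(A_{\mathrm N}(t,v)\big).$$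
   Context: Write $x=(x_1,\dots,x_m)\in\mathbb{R}^n$ and $f=(f_1,\dots,f_m)$. Standing assumptions: $f(t,x)$ is piecewise continuous in $t$, continuously differentiable in $x$, and $\dot x=f(t,x)$ is forward complete. $\xi(t,t_0,x)$ denotes the solution at time $t$ with state $x$ at time $t_0$, and $\xi(t,t_0,K):=\{\xi(t,t_0,x):x\in K\}$. $J_{x_j}f_i(t,v)$ is the Jacobian matrix of $f_i(t,x)$ with respect to $x_j$ at $x=v$. $\operatorname{co}$ denotes convex hull. Norms: for each $i$, a ("local") norm $|\cdot|_i$ on $\mathbb{R}^{n_i}$ is given, with induced norm $\|\cdot\|_i$ on $\mathbb{R}^{n_i\times n_i}$ and mixed induced norms $\|A\|_{ij}:=\max_{|v|_j=1}|Av|_i$ on $\mathbb{R}^{n_i\times n_j}$. Also given is a ("network") norm $|\cdot|_{\mathrm N}$ on $\mathbb{R}^m$ that is monotone: for all entrywise nonnegative $v,w\in\mathbb{R}^m$, $v\ge w$ entrywise implies $|v|_{\mathrm N}\ge|w|_{\mathrm N}$; its induced norm on $\mathbb{R}^{m\times m}$ is $\|\cdot\|_{\mathrm N}$. The matrix measure of an induced norm $\|\cdot\|$ is $\mu(A):=\lim_{t\searrow0}\frac{\|I+tA\|-1}{t}$; $\mu_i$ and $\mu_{\mathrm N}$ are the matrix measures of $\|\cdot\|_i$ and $\|\cdot\|_{\mathrm N}$. Topological entropy: fix a norm $|\cdot|$ on $\mathbb{R}^n$ (the entropy does not depend on this choice). For $T\ge0$, $\varepsilon>0$, let $B_{f,t_0}(x,\varepsilon,T):=\{\bar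 x\in\mathbb{R}^n:\max_{t\in[t_0,t_0+T]}|\xi(t,t_0,\bar x)-\xi(t,t_0,x)|<\varepsilon\}$. A subset $E\subset K$ is $(T,\varepsilon)$-spanning if $K\subset\bigcup_{x\in E}B_{f,t_0}(x,\varepsilon,T)$; $S(f,t_0,\varepsilon,T,K)$ is the minimal cardinality of a $(T,\varepsilon)$-spanning set. Then $h(f,t_0,K):=\lim_{\varepsilon\searrow0}\limsup_{T\to\infty}\frac1T\log S(f,t_0,\varepsilon,T,K)$ (natural logarithm).
   Formalization: "Continuously differentiable in x" is taken to include that f is Lipschitz in x on bounded sets, uniformly for t in bounded intervals; with separate regularity in t and x only, solutions may be non-unique or unbounded on K and the bound can fail. *)

theory Defs
  imports "HOL-Analysis.Analysis" "HOL-Library.Extended_Nat"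
begin

section \<open>Norms on subspaces, induced norms, matrix measures\<close>

definition norm_on :: "'a::real_vector set \<Rightarrow> ('a \<Rightarrow> real) \<Rightarrow> bool" where
  "norm_on S p \<longleftrightarrow>
     (\<forall>v\<in>S. 0 \<le> p v \<and> (p v = 0 \<longleftrightarrow> v = 0)) \<and>
     (\<forall>c. \<forall>v\<in>S. p (c *\<^sub>R v) = \<bar>c\<bar> * p v) \<and>
     (\<forall>v\<in>S. \<forall>w\<in>S. p (v + w) \<le> p v + p w)"

definition monotone_norm :: "(real ^ 'm \<Rightarrow> real) \<Rightarrow> bool" where
  "monotone_norm p \<longleftrightarrow> norm_on UNIV p \<and>
     (\<forall>v w. (\<forall>i. 0 \<le> v $ i) \<and> (\<forall>i. 0 \<le> w $ i) \<and> (\<forall>i. v $ i \<ge> w $ i) \<longrightarrow> p v \<ge> p w)"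

text \<open>Mixed induced norm of \<open>A\<close>, regarded as a map on the subspace \<open>S\<close> carrying the norm \<open>p\<close>
  into a subspace carrying the norm \<open>q\<close>. For \<open>S \<noteq> {0}\<close> the supremum is a maximum, because
  the unit sphere of \<open>S\<close> is compact and nonempty.\<close>

definition mixed_norm ::
  "(real ^ 'n) set \<Rightarrow> (real ^ 'n \<Rightarrow> real) \<Rightarrow> (real ^ 'k \<Rightarrow> real) \<Rightarrow> real ^ 'n ^ 'k \<Rightarrow> real" where
  "mixed_norm S p q A = (SUP v\<in>{v\<in>S. p v = 1}. q (A *v v))"

text \<open>The matrix \<open>mat 1\<close> acts on \<open>S\<close> as the identity of \<open>S\<close>, so no separate
  identity matrix of the subspace is needed.\<close>

definition matrix_measure ::
  "(real ^ 'n) set \<Rightarrow> (real ^ 'n \<Rightarrow> real) \<Rightarrow> real ^ 'n ^ 'n \<Rightarrow> real" where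
  "matrix_measure S p A = Lim (at_right 0) (\<lambda>t. (mixed_norm S p p (mat 1 + t *\<^sub>R A) - 1) / t)"


section \<open>Block decomposition of the state space\<close>

text \<open>A map \<open>b\<close> from coordinates onto block indices splits the coordinates of the state
  \<open>x = (x\<^sub>1, \<dots>, x\<^sub>m)\<close>: coordinate \<open>k\<close> belongs to \<open>x\<^sub>i\<close> iff \<open>b k = i\<close>, and the block
  dimension is the cardinality of the fibre of \<open>b\<close> over \<open>i\<close>. The space of \<open>x\<^sub>i\<close> is
  represented by the corresponding coordinate subspace of the state space, and the block of a
  matrix with rows in \<open>i\<close> and columns in \<open>j\<close> is padded with zeros.\<close>

definition block_space :: "('n \<Rightarrow> 'm) \<Rightarrow> 'm \<Rightarrow> (real ^ 'n) set" where
  "block_space b i = {x. \<forall>k. b k \<noteq> i \<longrightarrow> x $ k = 0}"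

definition matrix_block :: "('n \<Rightarrow> 'm) \<Rightarrow> 'm \<Rightarrow> 'm \<Rightarrow> real ^ 'n ^ 'n \<Rightarrow> real ^ 'n ^ 'n" where
  "matrix_block b i j A = (\<chi> k l. if b k = i \<and> b l = j then A $ k $ l else 0)"

definition block_jacobian ::
  "('n::finite \<Rightarrow> 'm) \<Rightarrow> 'm \<Rightarrow> 'm \<Rightarrow> (real \<Rightarrow> real ^ 'n \<Rightarrow> real ^ 'n) \<Rightarrow> real \<Rightarrow> real ^ 'n
     \<Rightarrow> real ^ 'n ^ 'n" where
  "block_jacobian b i j f t v = matrix_block b i j (jacobian (f t) (at v))"

definition interconnection_matrix ::
  "('n::finite \<Rightarrow> 'm::finite) \<Rightarrow> ('m \<Rightarrow> real ^ 'n \<Rightarrow> real) \<Rightarrow> (real \<Rightarrow> real ^ 'n \<Rightarrow> real ^ 'n)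
     \<Rightarrow> real \<Rightarrow> real ^ 'n \<Rightarrow> real ^ 'm ^ 'm" where
  "interconnection_matrix b lnorm f t v =
     (\<chi> i j. if i = j then matrix_measure (block_space b i) (lnorm i) (block_jacobian b i i f t v)
            else mixed_norm (block_space b j) (lnorm j) (lnorm i) (block_jacobian b i j f t v))"


section \<open>Time-varying vector fields and their solutions\<close>

text \<open>The exceptional times do not depend on the state, there are finitely many of them in each
  bounded interval, and the one-sided limits exist there.\<close>

definition piecewise_continuous_in_time ::
  "real \<Rightarrow> (real \<Rightarrow> 'a::euclidean_space \<Rightarrow> 'a) \<Rightarrow> bool" where
  "piecewise_continuous_in_time t0 f \<longleftrightarrow>
     (\<exists>D. (\<forall>T. finite (D \<inter> {t0..T})) \<and>
        (\<forall>x. \<forall>t\<ge>t0.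
           (t \<notin> D \<longrightarrow> continuous (at t within {t0..}) (\<lambda>s. f s x)) \<and>
           (t \<in> D \<longrightarrow> (\<exists>l. ((\<lambda>s. f s x) \<longlongrightarrow> l) (at_right t)) \<and>
                       (t > t0 \<longrightarrow> (\<exists>l. ((\<lambda>s. f s x) \<longlongrightarrow> l) (at_left t))))))"

text \<open>Besides each \<open>f t\<close> being continuously differentiable, this asks for Lipschitz constants on
  bounded sets that are uniform in \<open>t\<close> on bounded time intervals. It holds automatically when the
  Jacobian is continuous in time and state jointly, up to jumps at the exceptional times. If
  continuity in time and in the state were only required separately, solutions would in general be
  neither unique nor bounded on compact sets of initial states.\<close>

definition continuously_differentiable_in_state ::
  "real \<Rightarrow> (real \<Rightarrow> real ^ 'n::finite \<Rightarrow> real ^ 'n) \<Rightarrow> bool" where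
  "continuously_differentiable_in_state t0 f \<longleftrightarrow>
     (\<forall>t\<ge>t0. (\<forall>x. f t differentiable (at x)) \<and>
              continuous_on UNIV (\<lambda>x. jacobian (f t) (at x))) \<and>
     (\<forall>T r. \<exists>L. \<forall>t\<in>{t0..T}. L-lipschitz_on (cball 0 r) (f t))"

definition is_solution ::
  "(real \<Rightarrow> 'a::euclidean_space \<Rightarrow> 'a) \<Rightarrow> real \<Rightarrow> 'a \<Rightarrow> (real \<Rightarrow> 'a) \<Rightarrow> bool" where
  "is_solution f t0 x \<phi> \<longleftrightarrow> \<phi> t0 = x \<and> continuous_on {t0..} \<phi> \<and>
     (\<exists>D. (\<forall>T. finite (D \<inter> {t0..T})) \<and>
        (\<forall>t>t0. t \<notin> D \<longrightarrow> (\<phi> has_vector_derivative f t (\<phi> t)) (at t)))"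

definition forward_complete :: "(real \<Rightarrow> 'a::euclidean_space \<Rightarrow> 'a) \<Rightarrow> real \<Rightarrow> bool" where
  "forward_complete f t0 \<longleftrightarrow> (\<forall>x. \<exists>\<phi>. is_solution f t0 x \<phi>)"

text \<open>Solutions are unconstrained before \<open>t0\<close>, so only their values at times \<open>t \<ge> t0\<close> are
  determined; hence the description ranges over the value and not over the function.\<close>

definition sol :: "(real \<Rightarrow> 'a::euclidean_space \<Rightarrow> 'a) \<Rightarrow> real \<Rightarrow> real \<Rightarrow> 'a \<Rightarrow> 'a" where
  "sol f t t0 x = (THE y. \<exists>\<phi>. is_solution f t0 x \<phi> \<and> \<phi> t = y)"


section \<open>Topological entropy\<close>

definition bowen_ball ::
  "('a \<Rightarrow> real) \<Rightarrow> (real \<Rightarrow> 'a::euclidean_space \<Rightarrow> 'a) \<Rightarrow> real \<Rightarrow> 'a \<Rightarrow> real \<Rightarrow> real \<Rightarrow> 'a set" where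
  "bowen_ball p f t0 x \<epsilon> T = {y. (SUP t\<in>{t0..t0 + T}. p (sol f t t0 y - sol f t t0 x)) < \<epsilon>}"

definition spanning ::
  "('a \<Rightarrow> real) \<Rightarrow> (real \<Rightarrow> 'a::euclidean_space \<Rightarrow> 'a) \<Rightarrow> real \<Rightarrow> real \<Rightarrow> real \<Rightarrow> 'a set \<Rightarrow> 'a set \<Rightarrow> bool"
  where
  "spanning p f t0 \<epsilon> T K E \<longleftrightarrow> E \<subseteq> K \<and> K \<subseteq> (\<Union>x\<in>E. bowen_ball p f t0 x \<epsilon> T)"

definition spanning_number ::
  "('a \<Rightarrow> real) \<Rightarrow> (real \<Rightarrow> 'a::euclidean_space \<Rightarrow> 'a) \<Rightarrow> real \<Rightarrow> real \<Rightarrow> real \<Rightarrow> 'a set \<Rightarrow> enat" where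
  "spanning_number p f t0 \<epsilon> T K = (INF E\<in>{E. finite E \<and> spanning p f t0 \<epsilon> T K E}. enat (card E))"

definition log_enat :: "enat \<Rightarrow> ereal" where
  "log_enat k = (case k of enat j \<Rightarrow> ereal (ln (real j)) | \<infinity> \<Rightarrow> \<infinity>)"

definition topological_entropy ::
  "('a \<Rightarrow> real) \<Rightarrow> (real \<Rightarrow> 'a::euclidean_space \<Rightarrow> 'a) \<Rightarrow> real \<Rightarrow> 'a set \<Rightarrow> ereal" where
  "topological_entropy p f t0 K =
     Lim (at_right 0)
       (\<lambda>\<epsilon>::real. Limsup at_top (\<lambda>T::real. log_enat (spanning_number p f t0 \<epsilon> T K) / ereal T))"

end

theory Submission
  imports Defs
begin

text \<open>Measure the difference \<open>z\<close> of two solutions in the global norm \<open>q\<close> obtained by applying the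
  network norm to the vector of local norms of the blocks. If \<open>u\<close> is a subgradient of \<open>q\<close> at
  \<open>z\<close>, then \<open>u \<bullet> z'\<close> bounds the left Dini derivative of \<open>q z\<close>; by the mean value theorem
  \<open>u \<bullet> z' = u \<bullet> J z\<close> for the Jacobian \<open>J\<close> at a point of the segment between the two states, and
  \<open>u \<bullet> J z \<le> (q (z + h J z) - q z) / h\<close>. Estimating blockwise and using that the network norm
  is monotone, the right-hand side is at most \<open>c q z\<close> as soon as \<open>c\<close> exceeds the matrix measure of
  the interconnection matrix. Hence separations eventually grow at most like \<open>exp (c t)\<close>, and
  spanning sets of the size of a grid of mesh proportional to \<open>exp (- c T)\<close> suffice.\<close>

section \<open>Norms on subspaces\<close>

lemma norm_onD:
  assumes "norm_on S q"
  shows norm_on_nonneg: "v \<in> S \<Longrightarrow> 0 \<le> q v"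
    and norm_on_eq_0: "v \<in> S \<Longrightarrow> q v = 0 \<longleftrightarrow> v = 0"
    and norm_on_scaleR: "v \<in> S \<Longrightarrow> q (c *\<^sub>R v) = \<bar>c\<bar> * q v"
    and norm_on_triangle: "v \<in> S \<Longrightarrow> w \<in> S \<Longrightarrow> q (v + w) \<le> q v + q w"
  using assms unfolding norm_on_def by blast+

lemma norm_on_UNIV_norm: "norm_on UNIV (norm :: 'a::real_normed_vector \<Rightarrow> real)"
  unfolding norm_on_def by (auto simp: norm_triangle_ineq)

lemma norm_on_sum:
  assumes "norm_on S q" "subspace S" "finite I" "\<And>i. i \<in> I \<Longrightarrow> v i \<in> S"
  shows "q (sum v I) \<le> (\<Sum>i\<in>I. q (v i))"
  using assms(3,4)
proof (induction I rule: finite_induct)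
  case empty
  then show ?case
    using norm_on_eq_0[OF assms(1), of 0] subspace_0[OF assms(2)] by simp
next
  case (insert i I)
  have "q (v i + sum v I) \<le> q (v i) + q (sum v I)"
    using insert assms(2) by (intro norm_on_triangle[OF assms(1)] subspace_sum) auto
  also have "\<dots> \<le> q (v i) + (\<Sum>i\<in>I. q (v i))"
    using insert by simp
  finally show ?case using insert by simp
qed

text \<open>Since \<open>q\<close> is known to be a norm only on \<open>S\<close>, the vector is
  expanded in an orthonormal basis of \<open>S\<close> itself, so that every summand stays inside
  \<open>S\<close>.\<close>

lemma norm_on_upper:
  fixes q :: "'a::euclidean_space \<Rightarrow> real"
  assumes "norm_on S q" "subspace S"
  obtains C where "C > 0" "\<And>v. v \<in> S \<Longrightarrow> q v \<le> C * norm v"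
proof -
  obtain B where B: "B \<subseteq> S" "pairwise orthogonal B" "\<And>x. x \<in> B \<Longrightarrow> norm x = 1"
      "independent B" "card B = dim S" "span B = S"
    using orthonormal_basis_subspace[OF assms(2)] by metis
  have fin: "finite B" using B(4) independent_imp_finite by blast
  have nn: "0 \<le> (\<Sum>b\<in>B. q b)"
    using B(1) norm_on_nonneg[OF assms(1)] by (intro sum_nonneg) auto
  have "q v \<le> (1 + (\<Sum>b\<in>B. q b)) * norm v" if v: "v \<in> S" for v
  proof -
    have exp: "(\<Sum>b\<in>B. (v \<bullet> b) *\<^sub>R b) = v"
      using orthonormal_basis_expand[OF B(2,3) _ fin] v B(6) by simp
    have "q v = q (\<Sum>b\<in>B. (v \<bullet> b) *\<^sub>R b)" by (simp only: exp)
    also have "\<dots> \<le> (\<Sum>b\<in>B. q ((v \<bullet> b) *\<^sub>R b))"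
      using B(1) assms(2) by (intro norm_on_sum[OF assms fin]) (auto intro: subspace_scale)
    also have "\<dots> = (\<Sum>b\<in>B. \<bar>v \<bullet> b\<bar> * q b)"
      using B(1) by (intro sum.cong) (auto simp: norm_on_scaleR[OF assms(1)])
    also have "\<dots> \<le> (\<Sum>b\<in>B. norm v * q b)"
    proof (intro sum_mono mult_right_mono)
      fix b assume b: "b \<in> B"
      show "\<bar>v \<bullet> b\<bar> \<le> norm v"
        using Cauchy_Schwarz_ineq2[of v b] B(3)[OF b] by simp
      show "0 \<le> q b" using B(1) b norm_on_nonneg[OF assms(1)] by blast
    qed
    also have "\<dots> = (\<Sum>b\<in>B. q b) * norm v" by (simp add: sum_distrib_left mult.commute)
    also have "\<dots> \<le> (1 + (\<Sum>b\<in>B. q b)) * norm v" by (simp add: algebra_simps)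
    finally show ?thesis .
  qed
  then show ?thesis using nn by (intro that[of "1 + (\<Sum>b\<in>B. q b)"]) auto
qed

lemma norm_on_diff_le:
  assumes "norm_on S q" "subspace S" "v \<in> S" "w \<in> S"
  shows "\<bar>q v - q w\<bar> \<le> q (v - w)"
proof -
  have vw: "v - w \<in> S" using assms(2-4) by (simp add: subspace_diff)
  have "q (w - v) = q (v - w)"
    using norm_on_scaleR[OF assms(1) vw, of "-1"] by simp
  then show ?thesis
    using norm_on_triangle[OF assms(1) vw assms(4)]
      norm_on_triangle[OF assms(1) subspace_diff[OF assms(2,4,3)] assms(3)] by simp
qed

lemma norm_on_continuous:
  fixes q :: "'a::euclidean_space \<Rightarrow> real"
  assumes "norm_on S q" "subspace S"
  shows "continuous_on S q"
proof -
  obtain C where C: "C > 0" "\<And>v. v \<in> S \<Longrightarrow> q v \<le> C * norm v"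
    using norm_on_upper[OF assms] by blast
  have "C-lipschitz_on S q"
    by (rule lipschitz_onI)
       (use C norm_on_diff_le[OF assms] in \<open>auto simp: dist_norm intro: order_trans subspace_diff[OF assms(2)]\<close>)
  then show ?thesis by (rule lipschitz_on_continuous_on)
qed

text \<open>By compactness \<open>q\<close> attains a positive minimum on the Euclidean unit sphere
  of \<open>S\<close>, and homogeneity extends the estimate to all of \<open>S\<close>. The sphere
  is empty exactly when \<open>S\<close> is trivial, which is treated first.\<close>

lemma norm_on_lower:
  fixes q :: "'a::euclidean_space \<Rightarrow> real"
  assumes "norm_on S q" "subspace S"
  obtains C where "C > 0" "\<And>v. v \<in> S \<Longrightarrow> norm v \<le> C * q v"
proof (cases "S \<inter> sphere 0 1 = {}")
  case True
  have "v = 0" if "v \<in> S" for v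
  proof (rule ccontr)
    assume "v \<noteq> 0"
    then have "(1 / norm v) *\<^sub>R v \<in> S \<inter> sphere 0 1"
      using subspace_scale[OF assms(2) that, of "1 / norm v"] by simp
    with True show False by simp
  qed
  then have "norm v \<le> 1 * q v" if "v \<in> S" for v
    using norm_on_nonneg[OF assms(1)] that by (metis mult_1 norm_zero)
  then show ?thesis by (rule that[OF zero_less_one])
next
  case False
  have "compact (S \<inter> sphere 0 1)"
    using closed_subspace[OF assms(2)] by (intro closed_Int_compact) auto
  then obtain w where w: "w \<in> S \<inter> sphere 0 1" "\<And>v. v \<in> S \<inter> sphere 0 1 \<Longrightarrow> q w \<le> q v"
    using continuous_attains_inf[OF _ False, of q] norm_on_continuous[OF assms]
    by (metis Int_lower1 continuous_on_subset)
  have qw: "q w > 0"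
    using w(1) norm_on_nonneg[OF assms(1), of w] norm_on_eq_0[OF assms(1), of w] by force
  have "norm v \<le> (1 / q w) * q v" if v: "v \<in> S" for v
  proof (cases "v = 0")
    case True
    then show ?thesis using norm_on_nonneg[OF assms(1) v] qw by simp
  next
    case False
    have "q w \<le> q ((1 / norm v) *\<^sub>R v)"
      using False subspace_scale[OF assms(2) v] by (intro w(2)) auto
    also have "\<dots> = q v / norm v"
      using norm_on_scaleR[OF assms(1) v] by simp
    finally show ?thesis using False qw by (simp add: field_simps)
  qed
  then show ?thesis using qw by (intro that[of "1 / q w"]) auto
qed

text \<open>A finite-dimensional Hahn-Banach argument: a hyperplane separates \<open>z\<close> from
  the convex set of vectors with \<open>q\<close>-value below \<open>q z\<close>, and its normal
  vector, suitably rescaled, is the subgradient.\<close>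

lemma norm_on_subgradient:
  fixes q :: "'a::euclidean_space \<Rightarrow> real"
  assumes "norm_on UNIV q"
  obtains u where "u \<bullet> z = q z" "\<And>v. u \<bullet> v \<le> q v"
proof (cases "z = 0")
  case True
  then show ?thesis
    using norm_onD[OF assms] by (intro that[of 0]) auto
next
  case False
  note q = norm_on_nonneg[OF assms UNIV_I] norm_on_eq_0[OF assms UNIV_I]
    norm_on_scaleR[OF assms UNIV_I] norm_on_triangle[OF assms UNIV_I UNIV_I]
  have qz: "q z > 0" using False q(1,2)[of z] by linarith
  have "convex {v. q v < q z}"
  proof (rule convexI, clarify)
    fix x y and s t :: real
    assume *: "q x < q z" "q y < q z" "0 \<le> s" "0 \<le> t" "s + t = 1"
    have "q (s *\<^sub>R x + t *\<^sub>R y) \<le> s * q x + t * q y"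
      using q(4)[of "s *\<^sub>R x" "t *\<^sub>R y"] * by (simp add: q(3))
    also have "\<dots> < q z" using * by (intro convex_bound_lt) auto
    finally show "q (s *\<^sub>R x + t *\<^sub>R y) < q z" .
  qed
  moreover have "{v. q v < q z} \<noteq> {}" using qz q(2)[of 0] by (auto intro!: exI[of _ 0])
  ultimately obtain a c where a: "a \<noteq> 0" "\<And>v. q v < q z \<Longrightarrow> a \<bullet> v \<le> c" "c \<le> a \<bullet> z"
    using separating_hyperplane_sets[of "{v. q v < q z}" "{z}"] by auto
  have key: "(a \<bullet> v) * q z \<le> (a \<bullet> z) * q v" for v
  proof (cases "v = 0")
    case False
    then have qv: "q v > 0" using q(1,2)[of v] by linarith
    \<comment> \<open>For \<open>r < 1\<close> the rescaled vector has \<open>q\<close>-value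
      \<open>r * q z\<close> and thus lies strictly inside the separated set; letting
      \<open>r\<close> tend to 1 gives the homogeneous inequality.\<close>
    have "r * ((a \<bullet> v) * q z / q v) \<le> a \<bullet> z" if r: "0 < r" "r < 1" for r
    proof -
      have "q ((r * q z / q v) *\<^sub>R v) < q z"
        using r qz qv by (simp add: q(3))
      from a(2)[OF this] a(3) show ?thesis by (simp add: field_simps)
    qed
    then have "(a \<bullet> v) * q z / q v \<le> a \<bullet> z" by (rule field_le_mult_one_interval)
    then show ?thesis using qv by (simp add: field_simps)
  qed (use q(2)[of 0] in simp)
  \<comment> \<open>Testing \<open>key\<close> with \<open>a\<close> itself shows that the
    normalising denominator \<open>a \<bullet> z\<close> is positive.\<close>
  have qa: "q a > 0" using a(1) q(1,2)[of a] by linarith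
  have "0 < (a \<bullet> a) * q z" using a(1) qz by simp
  then have "0 < (a \<bullet> z) * q a" using key[of a] by linarith
  then have az: "a \<bullet> z > 0" using qa by (simp add: zero_less_mult_iff)
  show ?thesis
    by (rule that[of "(q z / (a \<bullet> z)) *\<^sub>R a"]) (use az key in \<open>auto simp: field_simps\<close>)
qed

section \<open>Induced norms and matrix measures\<close>

text \<open>A real supremum is informative only over a bounded set. Equivalence with the Euclidean
  norm on both subspaces, together with boundedness of the linear map, provides the bound.\<close>

lemma mixed_norm_bdd_above:
  fixes A :: "real ^ 'n ^ 'k"
  assumes "norm_on S q" "subspace S" "norm_on S' q'" "subspace S'"
    "\<And>v. v \<in> S \<Longrightarrow> A *v v \<in> S'"
  shows "bdd_above ((\<lambda>v. q' (A *v v)) ` {v\<in>S. q v = 1})"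
proof -
  obtain C where C: "C > 0" "\<And>v. v \<in> S \<Longrightarrow> norm v \<le> C * q v"
    using norm_on_lower[OF assms(1,2)] by blast
  obtain C' where C': "C' > 0" "\<And>v. v \<in> S' \<Longrightarrow> q' v \<le> C' * norm v"
    using norm_on_upper[OF assms(3,4)] by blast
  obtain M where M: "\<And>v. norm (A *v v) \<le> norm v * M"
    using bounded_linear.nonneg_bounded[OF matrix_vector_mul_bounded_linear[of A]] by blast
  have "q' (A *v v) \<le> C' * (C * \<bar>M\<bar>)" if "v \<in> S" "q v = 1" for v
  proof -
    have "norm (A *v v) \<le> norm v * \<bar>M\<bar>"
      by (rule order_trans[OF M]) (simp add: mult_left_mono)
    also have "\<dots> \<le> C * \<bar>M\<bar>"
      using C(2)[of v] that by (simp add: mult_right_mono)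
    finally have "C' * norm (A *v v) \<le> C' * (C * \<bar>M\<bar>)"
      using C'(1) by (intro mult_left_mono) auto
    then show ?thesis
      using C'(2)[OF assms(5)[OF that(1)]] by linarith
  qed
  then show ?thesis by (intro bdd_aboveI2) auto
qed

lemma mixed_norm_bound:
  fixes A :: "real ^ 'n ^ 'k"
  assumes "norm_on S q" "subspace S" "norm_on S' q'" "subspace S'"
    "\<And>v. v \<in> S \<Longrightarrow> A *v v \<in> S'" and v: "v \<in> S"
  shows "q' (A *v v) \<le> mixed_norm S q q' A * q v"
proof (cases "v = 0")
  case True
  then show ?thesis
    using norm_on_eq_0[OF assms(1,6)] norm_on_eq_0[OF assms(3), of 0] subspace_0[OF assms(4)]
    by simp
next
  case False
  then have qv: "q v > 0"
    using norm_on_nonneg[OF assms(1) v] norm_on_eq_0[OF assms(1) v] by simp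
  let ?w = "(1 / q v) *\<^sub>R v"
  have w: "?w \<in> {v\<in>S. q v = 1}"
    using subspace_scale[OF assms(2) v] qv norm_on_scaleR[OF assms(1) v] by simp
  have "q' (A *v ?w) \<le> mixed_norm S q q' A"
    unfolding mixed_norm_def by (rule cSUP_upper[OF w mixed_norm_bdd_above[OF assms(1-5)]])
  also have "A *v ?w = (1 / q v) *\<^sub>R (A *v v)" by (simp add: matrix_vector_mult_scaleR)
  also have "q' \<dots> = q' (A *v v) / q v"
    using norm_on_scaleR[OF assms(3) assms(5)[OF v]] qv by simp
  finally show ?thesis using qv by (simp add: field_simps)
qed

lemma mat_1_plus_scaleR_vector: "(mat 1 + t *\<^sub>R A) *v v = v + t *\<^sub>R (A *v v)"
  for A :: "real ^ 'n ^ 'n"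
  by (simp add: matrix_vector_mult_add_rdistrib scaleR_matrix_vector_assoc)

text \<open>Convexity of the norm makes the difference quotient nondecreasing in \<open>t\<close>,
  and it is bounded below, so it converges to its infimum as \<open>t\<close> decreases to 0. This
  justifies the use of \<open>Lim\<close> in the definition. Nontriviality of \<open>S\<close>
  provides a unit vector, hence a nonempty set for the supremum.\<close>

lemma matrix_measure_tendsto:
  fixes A :: "real ^ 'n ^ 'n"
  assumes "norm_on S q" "subspace S" "S \<noteq> {0}" "\<And>v. v \<in> S \<Longrightarrow> A *v v \<in> S"
  shows "((\<lambda>t. (mixed_norm S q q (mat 1 + t *\<^sub>R A) - 1) / t) \<longlongrightarrow> matrix_measure S q A) (at_right 0)"
proof -
  let ?M = "\<lambda>t. mixed_norm S q q (mat 1 + t *\<^sub>R A)"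
  let ?g = "\<lambda>t. (?M t - 1) / t"
  have inv: "(mat 1 + t *\<^sub>R A) *v v \<in> S" if "v \<in> S" for t v
    unfolding mat_1_plus_scaleR_vector
    using assms(2,4) that by (intro subspace_add subspace_scale) auto
  have bound: "q ((mat 1 + t *\<^sub>R A) *v v) \<le> ?M t * q v" if "v \<in> S" for t v
    by (rule mixed_norm_bound[OF assms(1,2,1,2) inv that])
  obtain x where "x \<in> S" "x \<noteq> 0"
    using assms(2,3) subspace_0 by blast
  moreover from this have "q x > 0"
    using norm_on_nonneg[OF assms(1)] norm_on_eq_0[OF assms(1)] by (metis order_le_less)
  ultimately have w: "(1 / q x) *\<^sub>R x \<in> {v \<in> S. q v = 1}"
    using subspace_scale[OF assms(2)] norm_on_scaleR[OF assms(1)] by simp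
  then obtain w where w: "w \<in> S" "q w = 1" by blast
  \<comment> \<open>For \<open>s \<le> t\<close>, \<open>I + s A\<close> is the convex combination
    of \<open>I\<close> and \<open>I + t A\<close> with weights \<open>1 - s / t\<close> and
    \<open>s / t\<close>.\<close>
  have mono: "?g s \<le> ?g t" if st: "0 < s" "s \<le> t" for s t
  proof -
    have "?M s \<le> (1 - s / t) + (s / t) * ?M t"
      unfolding mixed_norm_def[of S q q "mat 1 + s *\<^sub>R A"]
    proof (rule cSUP_least)
      show "{v \<in> S. q v = 1} \<noteq> {}" using w by blast
    next
      fix v assume v: "v \<in> {v \<in> S. q v = 1}"
      have "(mat 1 + s *\<^sub>R A) *v v = (1 - s / t) *\<^sub>R v + (s / t) *\<^sub>R ((mat 1 + t *\<^sub>R A) *v v)"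
        unfolding mat_1_plus_scaleR_vector using st by (simp add: algebra_simps)
      also have "q \<dots> \<le> (1 - s / t) * q v + (s / t) * q ((mat 1 + t *\<^sub>R A) *v v)"
        using norm_on_triangle[OF assms(1), of "(1 - s / t) *\<^sub>R v" "(s / t) *\<^sub>R ((mat 1 + t *\<^sub>R A) *v v)"]
          v st inv[of v t] by (simp add: norm_on_scaleR[OF assms(1)] subspace_scale[OF assms(2)])
      also have "\<dots> \<le> (1 - s / t) + (s / t) * ?M t"
        using bound[of v t] v st by (auto intro!: add_mono mult_left_mono divide_right_mono)
      finally show "q ((mat 1 + s *\<^sub>R A) *v v) \<le> (1 - s / t) + (s / t) * ?M t" .
    qed
    then have "?M s - 1 \<le> s * ?g t" by (simp add: right_diff_distrib diff_divide_distrib)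
    then show ?thesis using st by (simp add: pos_divide_le_eq mult.commute)
  qed
  \<comment> \<open>The triangle inequality at one fixed unit vector \<open>w\<close> yields a lower
    bound independent of \<open>t\<close>.\<close>
  have lower: "- q (A *v w) \<le> ?g t" if t: "t > 0" for t
  proof -
    have "q w \<le> q (w + t *\<^sub>R (A *v w)) + q ((- t) *\<^sub>R (A *v w))"
      using norm_on_triangle[OF assms(1), of "w + t *\<^sub>R (A *v w)" "(- t) *\<^sub>R (A *v w)"] w assms(2,4)
      by (simp add: subspace_add subspace_scale subspace_neg)
    also have "q ((- t) *\<^sub>R (A *v w)) = t * q (A *v w)"
      using norm_on_scaleR[OF assms(1) assms(4)[OF w(1)], of "- t"] t by simp
    finally have "1 \<le> ?M t + t * q (A *v w)"
      using bound[OF w(1), of t] w by (simp add: mat_1_plus_scaleR_vector)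
    then show ?thesis using t by (simp add: field_simps)
  qed
  have bdd: "bdd_below (?g ` {0<..})"
    using lower by (intro bdd_belowI2) auto
  have "(?g \<longlongrightarrow> (INF t\<in>{0<..}. ?g t)) (at_right 0)"
  proof (rule order_tendstoI)
    fix a assume "a < (INF t\<in>{0<..}. ?g t)"
    then have "a < ?g t" if "t > 0" for t
      using cINF_lower[OF bdd, of t] that by simp
    then show "eventually (\<lambda>t. a < ?g t) (at_right 0)"
      by (rule eventually_mono[OF eventually_at_right_less])
  next
    fix a assume "(INF t\<in>{0<..}. ?g t) < a"
    then obtain t where t: "t > 0" "?g t < a"
      using cINF_less_iff[OF _ bdd] by auto
    have "?g s < a" if "0 < s" "s < t" for s
      using mono[of s t] that t by linarith
    then show "eventually (\<lambda>t. ?g t < a) (at_right 0)"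
      using t(1) unfolding eventually_at_right_field by blast
  qed
  moreover from this have "matrix_measure S q A = (INF t\<in>{0<..}. ?g t)"
    unfolding matrix_measure_def by (rule tendsto_Lim[OF trivial_limit_at_right_real])
  ultimately show ?thesis by simp
qed

text \<open>The strict inequality turns the limit into an estimate for all small steps, stated
  vectorwise so that later arguments no longer mention induced norms.\<close>

lemma matrix_measure_eventually:
  fixes A :: "real ^ 'n ^ 'n"
  assumes "norm_on S q" "subspace S" "S \<noteq> {0}" "\<And>v. v \<in> S \<Longrightarrow> A *v v \<in> S" "matrix_measure S q A < c"
  shows "eventually (\<lambda>t. \<forall>v\<in>S. q (v + t *\<^sub>R (A *v v)) \<le> (1 + t * c) * q v) (at_right 0)"
proof -
  have "eventually (\<lambda>t. (mixed_norm S q q (mat 1 + t *\<^sub>R A) - 1) / t < c) (at_right 0)"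
    using order_tendstoD(2)[OF matrix_measure_tendsto[OF assms(1-4)] assms(5)] .
  then show ?thesis
    using eventually_at_right_less[of "0::real"]
  proof eventually_elim
    case (elim t)
    show ?case
    proof
      fix v assume v: "v \<in> S"
      have "q (v + t *\<^sub>R (A *v v)) \<le> mixed_norm S q q (mat 1 + t *\<^sub>R A) * q v"
        unfolding mat_1_plus_scaleR_vector[symmetric] using assms(2,4) v
        by (intro mixed_norm_bound[OF assms(1,2,1,2)])
           (auto simp: mat_1_plus_scaleR_vector intro: subspace_add subspace_scale)
      also have "\<dots> \<le> (1 + t * c) * q v"
        using elim norm_on_nonneg[OF assms(1) v] by (intro mult_right_mono) (auto simp: field_simps)
      finally show "q (v + t *\<^sub>R (A *v v)) \<le> (1 + t * c) * q v" .
    qed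
  qed
qed

section \<open>The global norm built from the local norms and the network norm\<close>

lemma subspace_block_space: "subspace (block_space b i)"
  unfolding subspace_def block_space_def by auto

lemma block_space_nontrivial:
  assumes "surj b"
  shows "block_space b i \<noteq> {0}"
proof -
  obtain k where "b k = i" using assms by (metis surjD)
  then have "axis k 1 \<in> block_space b i - {0}"
    unfolding block_space_def by (auto simp: axis_def vec_eq_iff)
  then show ?thesis by blast
qed

section \<open>Decomposition of vectors and matrix products into blocks\<close>

definition block_part :: "('n \<Rightarrow> 'm) \<Rightarrow> 'm \<Rightarrow> real ^ 'n \<Rightarrow> real ^ 'n" where
  "block_part b i z = (\<chi> k. if b k = i then z $ k else 0)"

lemma block_part_in [simp]: "block_part b i z \<in> block_space b i"
  unfolding block_part_def block_space_def by auto

lemma block_part_add: "block_part b i (v + w) = block_part b i v + block_part b i w"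
  unfolding block_part_def by (simp add: vec_eq_iff)

lemma block_part_scaleR: "block_part b i (c *\<^sub>R v) = c *\<^sub>R block_part b i v"
  unfolding block_part_def by (simp add: vec_eq_iff)

lemma block_part_eq_0: "(\<forall>i. block_part b i z = 0) \<longleftrightarrow> z = 0"
  unfolding block_part_def by (auto simp: vec_eq_iff)

lemma matrix_block_in [simp]: "matrix_block b i j A *v v \<in> block_space b i"
  unfolding matrix_block_def block_space_def matrix_vector_mult_def by auto

lemma block_part_mult:
  fixes b :: "'n::finite \<Rightarrow> 'm::finite"
  shows "block_part b i (A *v z) = (\<Sum>j\<in>UNIV. matrix_block b i j A *v block_part b j z)"
proof -
  have "(\<Sum>j\<in>UNIV. \<Sum>l\<in>UNIV. (if b k = i \<and> b l = j then A $ k $ l else 0) * (if b l = j then z $ l else 0))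
      = (if b k = i then \<Sum>l\<in>UNIV. A $ k $ l * z $ l else 0)" for k
  proof -
    have "(\<Sum>j\<in>UNIV. (if b k = i \<and> b l = j then A $ k $ l else 0) * (if b l = j then z $ l else 0))
      = (if b k = i then A $ k $ l * z $ l else 0)" for l
    proof -
      \<comment> \<open>Coordinate \<open>l\<close> lies in exactly one block, so only
        \<open>j = b l\<close> contributes.\<close>
      have "(\<Sum>j\<in>UNIV. (if b k = i \<and> b l = j then A $ k $ l else 0) * (if b l = j then z $ l else 0))
        = (\<Sum>j\<in>UNIV. if j = b l then (if b k = i then A $ k $ l * z $ l else 0) else 0)"
        by (intro sum.cong) auto
      then show ?thesis by simp
    qed
    then show ?thesis by (subst sum.swap) (simp add: sum.If_cases)
  qed
  then show ?thesis
    unfolding block_part_def matrix_block_def matrix_vector_mult_def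
    by (simp add: vec_eq_iff)
qed

definition local_norms :: "('n \<Rightarrow> 'm) \<Rightarrow> ('m \<Rightarrow> real ^ 'n \<Rightarrow> real) \<Rightarrow> real ^ 'n \<Rightarrow> real ^ 'm" where
  "local_norms b lnorm z = (\<chi> i. lnorm i (block_part b i z))"

section \<open>The composite norm and its infinitesimal growth\<close>

locale composite_norm =
  fixes b :: "'n::finite \<Rightarrow> 'm::finite"
    and lnorm :: "'m \<Rightarrow> real ^ 'n \<Rightarrow> real"
    and nnorm :: "real ^ 'm \<Rightarrow> real"
  assumes surj_b: "surj b"
    and lnorm: "\<And>i. norm_on (block_space b i) (lnorm i)"
    and monotone_nnorm: "monotone_norm nnorm"
begin

abbreviation "gnorm z \<equiv> nnorm (local_norms b lnorm z)"

lemma nnorm: "norm_on UNIV nnorm"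
  using monotone_nnorm unfolding monotone_norm_def by blast

lemma nnorm_mono: "(\<And>i. 0 \<le> v $ i) \<Longrightarrow> (\<And>i. v $ i \<le> w $ i) \<Longrightarrow> nnorm v \<le> nnorm w"
  using monotone_nnorm unfolding monotone_norm_def by (meson order_trans)

lemma local_norms_nonneg: "0 \<le> local_norms b lnorm z $ i"
  unfolding local_norms_def using norm_on_nonneg[OF lnorm] by simp

text \<open>Only the triangle inequality needs more than the norm axioms: the local triangle
  inequalities are entrywise, and monotonicity of \<open>nnorm\<close> is what carries them
  over.\<close>

lemma norm_on_gnorm: "norm_on UNIV gnorm"
  unfolding norm_on_def
proof (intro conjI ballI allI)
  fix v w :: "real ^ 'n" and c :: real
  note N = norm_on_nonneg[OF nnorm UNIV_I] norm_on_eq_0[OF nnorm UNIV_I]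
    norm_on_scaleR[OF nnorm UNIV_I] norm_on_triangle[OF nnorm UNIV_I UNIV_I]
  show "0 \<le> gnorm v" by (rule N)
  have "local_norms b lnorm v = 0 \<longleftrightarrow> (\<forall>i. lnorm i (block_part b i v) = 0)"
    by (simp add: local_norms_def vec_eq_iff)
  also have "\<dots> \<longleftrightarrow> (\<forall>i. block_part b i v = 0)"
    by (simp add: norm_on_eq_0[OF lnorm])
  finally have "local_norms b lnorm v = 0 \<longleftrightarrow> (\<forall>i. block_part b i v = 0)" .
  then show "gnorm v = 0 \<longleftrightarrow> v = 0" by (simp add: N block_part_eq_0)
  have "local_norms b lnorm (c *\<^sub>R v) = \<bar>c\<bar> *\<^sub>R local_norms b lnorm v"
    unfolding local_norms_def by (simp add: vec_eq_iff block_part_scaleR norm_on_scaleR[OF lnorm])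
  then show "gnorm (c *\<^sub>R v) = \<bar>c\<bar> * gnorm v" by (simp add: N)
  have "gnorm (v + w) \<le> nnorm (local_norms b lnorm v + local_norms b lnorm w)"
    by (intro nnorm_mono local_norms_nonneg)
       (simp add: local_norms_def block_part_add norm_on_triangle[OF lnorm])
  also have "\<dots> \<le> gnorm v + gnorm w" by (rule N)
  finally show "gnorm (v + w) \<le> gnorm v + gnorm w" .
qed

text \<open>An Euler step is estimated block by block: the diagonal block through its matrix
  measure, the other blocks through mixed norms. Monotonicity of \<open>nnorm\<close> reduces the
  claim to an Euler step of the interconnection matrix acting on the vector of local norms.\<close>

lemma gnorm_step_bound:
  assumes c: "matrix_measure UNIV nnorm (interconnection_matrix b lnorm f t v) < c"
  shows "eventually (\<lambda>h. gnorm (z + h *\<^sub>R (jacobian (f t) (at v) *v z)) \<le> (1 + h * c) * gnorm z) (at_right 0)"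
proof -
  define J where "J = jacobian (f t) (at v)"
  define A where "A = interconnection_matrix b lnorm f t v"
  define \<zeta> where "\<zeta> = local_norms b lnorm z"
  \<comment> \<open>The gap between the network measure and \<open>c\<close> is split:
    \<open>c'\<close> serves the strict bound for the network norm, and \<open>e = c - c'\<close>
    absorbs the excess allowed in every diagonal block.\<close>
  obtain c' where c': "matrix_measure UNIV nnorm A < c'" "c' < c"
    using c dense unfolding A_def by blast
  define e where "e = c - c'"
  have e: "e > 0" using c' by (simp add: e_def)
  have diag: "eventually (\<lambda>h. \<forall>w\<in>block_space b i. lnorm i (w + h *\<^sub>R (matrix_block b i i J *v w))
      \<le> (1 + h * (A $ i $ i + e)) * lnorm i w) (at_right 0)" for i
    by (rule matrix_measure_eventually[OF lnorm subspace_block_space block_space_nontrivial[OF surj_b]])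
       (use e in \<open>simp_all add: A_def J_def interconnection_matrix_def block_jacobian_def\<close>)
  have off: "lnorm i (matrix_block b i j J *v block_part b j z) \<le> A $ i $ j * \<zeta> $ j" if "i \<noteq> j" for i j
  proof -
    have "lnorm i (matrix_block b i j J *v block_part b j z)
        \<le> mixed_norm (block_space b j) (lnorm j) (lnorm i) (matrix_block b i j J) * lnorm j (block_part b j z)"
      by (rule mixed_norm_bound[where S' = "block_space b i"]) (auto intro: lnorm subspace_block_space)
    then show ?thesis using that
      by (simp add: A_def J_def \<zeta>_def local_norms_def interconnection_matrix_def block_jacobian_def)
  qed
  have "eventually (\<lambda>h. \<forall>w\<in>UNIV. nnorm (w + h *\<^sub>R (A *v w)) \<le> (1 + h * c') * nnorm w) (at_right 0)"
  proof (rule matrix_measure_eventually[OF nnorm])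
    have "axis undefined 1 \<noteq> (0 :: real ^ 'm)" by simp
    then show "(UNIV :: (real ^ 'm) set) \<noteq> {0}" by blast
  qed (use c' in auto)
  moreover have "eventually (\<lambda>h. \<forall>i. \<forall>w\<in>block_space b i. lnorm i (w + h *\<^sub>R (matrix_block b i i J *v w))
      \<le> (1 + h * (A $ i $ i + e)) * lnorm i w) (at_right 0)"
    using eventually_all_finite[OF diag] .
  ultimately show ?thesis
    using eventually_at_right_less[of "0::real"]
  proof eventually_elim
    case (elim h)
    \<comment> \<open>The diagonal block is kept together with the identity, because a matrix
      measure may be negative and controls only the sum of the two; the off-diagonal blocks are
      split off by the triangle inequality.\<close>
    have "local_norms b lnorm (z + h *\<^sub>R (J *v z)) $ i \<le> ((\<zeta> + h *\<^sub>R (A *v \<zeta>)) + (h * e) *\<^sub>R \<zeta>) $ i" for i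
    proof -
      let ?s = "\<Sum>j\<in>UNIV - {i}. matrix_block b i j J *v block_part b j z"
      have s: "?s \<in> block_space b i" by (intro subspace_sum subspace_block_space) simp
      have "block_part b i (z + h *\<^sub>R (J *v z)) =
          (block_part b i z + h *\<^sub>R (matrix_block b i i J *v block_part b i z)) + h *\<^sub>R ?s"
        unfolding block_part_add block_part_scaleR block_part_mult
        by (subst sum.remove[of UNIV i]) (auto simp: scaleR_add_right)
      then have "lnorm i (block_part b i (z + h *\<^sub>R (J *v z))) \<le>
          lnorm i (block_part b i z + h *\<^sub>R (matrix_block b i i J *v block_part b i z)) + lnorm i (h *\<^sub>R ?s)"
        using norm_on_triangle[OF lnorm, of "block_part b i z + h *\<^sub>R (matrix_block b i i J *v block_part b i z)" i "h *\<^sub>R ?s"] s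
        by (simp add: subspace_add subspace_scale subspace_block_space)
      also have "\<dots> \<le> (1 + h * (A $ i $ i + e)) * \<zeta> $ i + lnorm i (h *\<^sub>R ?s)"
        using elim(2) by (simp add: \<zeta>_def local_norms_def)
      also have "lnorm i (h *\<^sub>R ?s) = h * lnorm i ?s"
        using norm_on_scaleR[OF lnorm s, of h] elim(3) by simp
      also have "lnorm i ?s \<le> (\<Sum>j\<in>UNIV - {i}. lnorm i (matrix_block b i j J *v block_part b j z))"
        by (intro norm_on_sum[OF lnorm subspace_block_space]) auto
      also have "\<dots> \<le> (\<Sum>j\<in>UNIV - {i}. A $ i $ j * \<zeta> $ j)"
        by (intro sum_mono off) auto
      also have "(1 + h * (A $ i $ i + e)) * \<zeta> $ i + h * (\<Sum>j\<in>UNIV - {i}. A $ i $ j * \<zeta> $ j) =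
          \<zeta> $ i + h * (\<Sum>j\<in>UNIV. A $ i $ j * \<zeta> $ j) + h * e * \<zeta> $ i"
        by (subst sum.remove[of UNIV i]) (auto simp: algebra_simps)
      finally show ?thesis
        using elim(3) by (simp add: local_norms_def matrix_vector_mult_def)
    qed
    then have "gnorm (z + h *\<^sub>R (J *v z)) \<le> nnorm ((\<zeta> + h *\<^sub>R (A *v \<zeta>)) + (h * e) *\<^sub>R \<zeta>)"
      by (intro nnorm_mono local_norms_nonneg)
    also have "\<dots> \<le> nnorm (\<zeta> + h *\<^sub>R (A *v \<zeta>)) + nnorm ((h * e) *\<^sub>R \<zeta>)"
      by (rule norm_on_triangle[OF nnorm UNIV_I UNIV_I])
    also have "nnorm ((h * e) *\<^sub>R \<zeta>) = h * e * nnorm \<zeta>"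
      using norm_on_scaleR[OF nnorm UNIV_I, of "h * e" \<zeta>] elim(3) e by simp
    also have "nnorm (\<zeta> + h *\<^sub>R (A *v \<zeta>)) \<le> (1 + h * c') * nnorm \<zeta>"
      using elim(1) by blast
    finally show ?case
      by (simp add: J_def \<zeta>_def e_def algebra_simps)
  qed
qed

text \<open>Testing an Euler step with \<open>u\<close> gives \<open>gnorm z\<close> plus
  \<open>h\<close> times the left-hand side, while the step has norm at most
  \<open>(1 + h * c) * gnorm z\<close>; the terms \<open>gnorm z\<close> cancel, and one small
  positive \<open>h\<close> is enough.\<close>

lemma subgradient_jacobian_bound:
  assumes u: "u \<bullet> z = gnorm z" "\<And>v. u \<bullet> v \<le> gnorm v"
    and c: "matrix_measure UNIV nnorm (interconnection_matrix b lnorm f t v) < c"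
  shows "u \<bullet> (jacobian (f t) (at v) *v z) \<le> c * gnorm z"
proof -
  have "eventually (\<lambda>h. 0 < h \<and> gnorm (z + h *\<^sub>R (jacobian (f t) (at v) *v z)) \<le> (1 + h * c) * gnorm z) (at_right 0)"
    using gnorm_step_bound[OF c, of z] eventually_at_right_less[of "0::real"]
    by eventually_elim auto
  then obtain h where h: "h > 0"
      "gnorm (z + h *\<^sub>R (jacobian (f t) (at v) *v z)) \<le> (1 + h * c) * gnorm z"
    using eventually_happens' trivial_limit_at_right_real by blast
  have "h * (u \<bullet> (jacobian (f t) (at v) *v z)) \<le> h * (c * gnorm z)"
    using h(2) u(1) u(2)[of "z + h *\<^sub>R (jacobian (f t) (at v) *v z)"]
    by (simp add: inner_add_right algebra_simps)
  then show ?thesis using h(1) by simp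
qed

text \<open>Since only the scalar function \<open>u \<bullet> f t\<close> is differentiated along the segment,
  the ordinary mean value theorem suffices.\<close>

lemma subgradient_increment_bound:
  assumes u: "u \<bullet> (x - y) = gnorm (x - y)" "\<And>v. u \<bullet> v \<le> gnorm v"
    and diff: "\<And>v. f t differentiable (at v)"
    and c: "\<And>v. v \<in> closed_segment y x \<Longrightarrow>
      matrix_measure UNIV nnorm (interconnection_matrix b lnorm f t v) < c"
  shows "u \<bullet> (f t x - f t y) \<le> c * gnorm (x - y)"
proof -
  define g where "g s = u \<bullet> f t (y + s *\<^sub>R (x - y))" for s :: real
  have der: "(g has_real_derivative u \<bullet> (jacobian (f t) (at (y + s *\<^sub>R (x - y))) *v (x - y))) (at s)" for s
  proof -
    have *: "((\<lambda>s. y + s *\<^sub>R (x - y)) has_derivative (\<lambda>h. h *\<^sub>R (x - y))) (at s)"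
      by (auto intro!: derivative_eq_intros)
    have "(f t has_derivative (*v) (jacobian (f t) (at (y + s *\<^sub>R (x - y))))) (at (y + s *\<^sub>R (x - y)))"
      using diff jacobian_works by blast
    from has_derivative_compose[OF * this]
    have "(g has_derivative (\<lambda>h. u \<bullet> (jacobian (f t) (at (y + s *\<^sub>R (x - y))) *v (h *\<^sub>R (x - y))))) (at s)"
      unfolding g_def by (rule has_derivative_inner_right)
    then show ?thesis
      unfolding has_field_derivative_def
      by (simp add: matrix_vector_mult_scaleR mult.commute[of _ "u \<bullet> _"])
  qed
  obtain s where s: "0 < s" "s < 1"
      "g 1 - g 0 = (1 - 0) * (u \<bullet> (jacobian (f t) (at (y + s *\<^sub>R (x - y))) *v (x - y)))"
    using MVT2[OF zero_less_one, of g, OF der] by blast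
  have "y + s *\<^sub>R (x - y) \<in> closed_segment y x"
    unfolding in_segment using s by (intro exI[of _ s]) (auto simp: algebra_simps)
  from subgradient_jacobian_bound[OF u c[OF this]] s(3) show ?thesis
    by (simp add: g_def inner_diff_right)
qed

end

section \<open>Growth of curves whose velocity is controlled by subgradients\<close>

text \<open>Subtracting a small slope \<open>d\<close> forces the maximum over a compact subinterval
  to its left end, since a maximum further right would require left increments of at least
  \<open>h * d\<close>. Letting \<open>d\<close> shrink gives monotonicity in the open interval, and
  continuity adds the endpoints.\<close>

lemma nonincreasing_from_left_Dini:
  fixes g :: "real \<Rightarrow> real"
  assumes "a \<le> b" "continuous_on {a..b} g"
    and dini: "\<And>t e. a < t \<Longrightarrow> t < b \<Longrightarrow> e > 0 \<Longrightarrow>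
      eventually (\<lambda>h. g t - g (t - h) \<le> h * e) (at_right 0)"
  shows "g b \<le> g a"
proof (cases "a = b")
  case False
  then have ab: "a < b" using assms(1) by simp
  have open_le: "g t \<le> g s" if st: "a < s" "s < t" "t < b" for s t
  proof (rule field_le_epsilon)
    fix e :: real assume "e > 0"
    define d where "d = e / (t - s)"
    have d: "d > 0" using \<open>e > 0\<close> st by (simp add: d_def)
    define k where "k r = g r - d * (r - s)" for r
    have "continuous_on {s..t} k"
      unfolding k_def using st by (intro continuous_intros continuous_on_subset[OF assms(2)]) auto
    then obtain m where m: "m \<in> {s..t}" "\<And>r. r \<in> {s..t} \<Longrightarrow> k r \<le> k m"
      using continuous_attains_sup[of "{s..t}" k] st by auto
    have "m = s"
    proof (rule ccontr)
      assume "m \<noteq> s"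
      then have ms: "s < m" using m(1) by simp
      have "eventually (\<lambda>h. h < m - s) (at_right (0::real))"
        unfolding eventually_at_right_field using ms by (intro exI[of _ "m - s"]) auto
      moreover have "eventually (\<lambda>h. g m - g (m - h) \<le> h * (d / 2)) (at_right 0)"
        using dini[of m "d / 2"] ms m(1) st d by auto
      ultimately have "eventually (\<lambda>h. 0 < h \<and> h < m - s \<and> g m - g (m - h) \<le> h * (d / 2)) (at_right 0)"
        using eventually_at_right_less[of "0::real"] by eventually_elim auto
      then obtain h where h: "0 < h" "h < m - s" "g m - g (m - h) \<le> h * (d / 2)"
        using eventually_happens' trivial_limit_at_right_real by blast
      have "k (m - h) \<le> k m" using h m(1) by (intro m(2)) auto
      then have "d * h \<le> g m - g (m - h)" by (simp add: k_def algebra_simps)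
      moreover have "h * d > 0" using h(1) d by simp
      ultimately show False using h(3) by (simp add: mult.commute)
    qed
    then have "k t \<le> k s" using m(2)[of t] st by simp
    then show "g t \<le> g s + e" using st by (simp add: k_def d_def)
  qed
  have left: "g t \<le> g a" if "a < t" "t < b" for t
  proof (rule tendsto_lowerbound)
    show "(g \<longlongrightarrow> g a) (at_right a)"
      using continuous_on_Icc_at_rightD[OF assms(2) ab] .
    show "eventually (\<lambda>s. g t \<le> g s) (at_right a)"
      unfolding eventually_at_right_field using open_le that by blast
  qed simp
  show ?thesis
  proof (rule tendsto_upperbound)
    show "(g \<longlongrightarrow> g b) (at_left b)"
      using continuous_on_Icc_at_leftD[OF assms(2) ab] .
    show "eventually (\<lambda>s. g s \<le> g a) (at_left b)"
      unfolding eventually_at_left_field using left ab by blast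
  qed simp
qed simp

text \<open>Induction on the exceptional points: an interval containing the new point
  \<open>d\<close> in its interior is cut there. The halves can be joined because the derivative
  condition concerns only interior points, while continuity holds up to the ends.\<close>

lemma nonincreasing_from_left_Dini_except_finite:
  fixes g :: "real \<Rightarrow> real"
  assumes "finite D" "a \<le> b" "continuous_on {a..b} g"
    and "\<And>t e. a < t \<Longrightarrow> t < b \<Longrightarrow> t \<notin> D \<Longrightarrow> e > 0 \<Longrightarrow>
      eventually (\<lambda>h. g t - g (t - h) \<le> h * e) (at_right 0)"
  shows "g b \<le> g a"
  using assms
proof (induction D arbitrary: a b rule: finite_induct)
  case empty
  show ?case
    by (rule nonincreasing_from_left_Dini[OF empty.prems(1,2)], rule empty.prems(3)) simp_all
next
  case (insert d D)
  have sub: "g s \<le> g r" if rs: "r \<le> s" "a \<le> r" "s \<le> b" and d: "d \<le> r \<or> s \<le> d" for r s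
  proof (rule insert.IH[OF rs(1)])
    show "continuous_on {r..s} g"
      using rs by (intro continuous_on_subset[OF insert.prems(2)]) auto
    fix t e :: real assume "r < t" "t < s" "t \<notin> D" "e > 0"
    then show "eventually (\<lambda>h. g t - g (t - h) \<le> h * e) (at_right 0)"
      using rs d by (intro insert.prems(3)) auto
  qed
  show ?case
  proof (cases "a < d \<and> d < b")
    case True
    have "g b \<le> g d" using True by (intro sub) auto
    also have "g d \<le> g a" using True by (intro sub) auto
    finally show ?thesis .
  next
    case False
    then show ?thesis using insert.prems(1) by (intro sub) auto
  qed
qed

text \<open>If \<open>u\<close> is a subgradient of \<open>q\<close> at \<open>z t\<close>, then \<open>q (z t) - q (z (t - h)) \<le> u \<bullet> (z t - z (t - h))\<close>,
  so \<open>u \<bullet> z' t\<close> bounds the left Dini derivative of \<open>q \<circ> z\<close>.\<close>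

lemma norm_exponential_growth:
  fixes z :: "real \<Rightarrow> 'a::euclidean_space"
  assumes q: "norm_on UNIV q" and "finite D" "a \<le> b" and cont: "continuous_on {a..b} z"
    and der: "\<And>t. a < t \<Longrightarrow> t < b \<Longrightarrow> t \<notin> D \<Longrightarrow> (z has_vector_derivative z' t) (at t)"
    and bound: "\<And>t u. a < t \<Longrightarrow> t < b \<Longrightarrow> t \<notin> D \<Longrightarrow> u \<bullet> z t = q (z t) \<Longrightarrow>
      (\<And>v. u \<bullet> v \<le> q v) \<Longrightarrow> u \<bullet> z' t \<le> c * q (z t)"
  shows "q (z b) \<le> exp (c * (b - a)) * q (z a)"
proof -
  note q_scale = norm_on_scaleR[OF q UNIV_I]
  \<comment> \<open>The factor removes the expected growth, so that it remains to show that
    \<open>q (y t)\<close> does not increase.\<close>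
  define y where "y t = exp (- c * t) *\<^sub>R z t" for t
  have "q (y b) \<le> q (y a)"
  proof (rule nonincreasing_from_left_Dini_except_finite[OF assms(2,3), of "\<lambda>t. q (y t)"])
    have "continuous_on {a..b} y"
      unfolding y_def by (intro continuous_intros cont)
    then show "continuous_on {a..b} (\<lambda>t. q (y t))"
      using continuous_on_compose2[OF norm_on_continuous[OF q subspace_UNIV]] by blast
  next
    fix t e :: real assume t: "a < t" "t < b" "t \<notin> D" and e: "e > 0"
    define y' where "y' = exp (- c * t) *\<^sub>R (z' t - c *\<^sub>R z t)"
    obtain u where u: "u \<bullet> y t = q (y t)" "\<And>v. u \<bullet> v \<le> q v"
      using norm_on_subgradient[OF q] by blast
    \<comment> \<open>As \<open>y t\<close> is a positive multiple of \<open>z t\<close>, a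
      subgradient at one is a subgradient at the other, so the hypothesis \<open>bound\<close>
      applies to \<open>u\<close>.\<close>
    have uz: "u \<bullet> z t = q (z t)"
      using u(1) by (simp add: y_def q_scale)
    have uy': "u \<bullet> y' \<le> 0"
      using bound[OF t uz u(2)] uz
      by (simp add: y'_def inner_diff_right mult_le_0_iff)
    have "((\<lambda>t. exp (- c * t)) has_real_derivative exp (- c * t) * (- c)) (at t)"
      by (auto intro!: derivative_eq_intros)
    from has_vector_derivative_scaleR[OF this der[OF t]]
    have "(y has_vector_derivative y') (at t)"
      unfolding y_def y'_def by (simp add: algebra_simps)
    then have "((\<lambda>s. u \<bullet> y s) has_real_derivative u \<bullet> y') (at t)"
      unfolding has_real_derivative_iff_has_vector_derivative
      by (rule bounded_linear.has_vector_derivative[OF bounded_linear_inner_right])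
    then have "((\<lambda>h. (u \<bullet> y (t + h) - u \<bullet> y t) / h) \<longlongrightarrow> u \<bullet> y') (at 0)"
      unfolding DERIV_def .
    then have lim: "((\<lambda>h. (u \<bullet> y (t + h) - u \<bullet> y t) / h) \<longlongrightarrow> u \<bullet> y') (at_left 0)"
      by (rule filterlim_mono) (auto simp: at_within_le_at)
    have "eventually (\<lambda>h. (u \<bullet> y (t + h) - u \<bullet> y t) / h < e) (at_left 0)"
      using uy' e by (intro order_tendstoD(2)[OF lim]) simp
    \<comment> \<open>Reflection of \<open>h\<close> expresses the left difference quotient with
      positive increments.\<close>
    then have "eventually (\<lambda>h. (u \<bullet> y (t - h) - u \<bullet> y t) / (- h) < e) (at_right 0)"
      by (simp add: eventually_at_left_to_right)
    then show "eventually (\<lambda>h. q (y t) - q (y (t - h)) \<le> h * e) (at_right 0)"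
      using eventually_at_right_less[of "0::real"]
    proof eventually_elim
      case (elim h)
      have "q (y t) - q (y (t - h)) \<le> u \<bullet> y t - u \<bullet> y (t - h)"
        using u(1) u(2)[of "y (t - h)"] by simp
      also have "\<dots> \<le> h * e" using elim by (simp add: field_simps)
      finally show ?case .
    qed
  qed
  then have "exp (c * b) * (exp (- c * b) * q (z b)) \<le> exp (c * b) * (exp (- c * a) * q (z a))"
    by (simp add: y_def q_scale)
  then show ?thesis
    by (simp add: mult.assoc[symmetric] exp_add[symmetric] right_diff_distrib)
qed

section \<open>Solutions\<close>

text \<open>The previous growth estimate is applied to the difference of two solutions, with the
  union of their exceptional times. The estimate on \<open>f\<close> is required only along these
  two trajectories, so it may later depend on the set in which they stay.\<close>

lemma solutions_growth:
  assumes q: "norm_on UNIV q" and \<phi>: "is_solution f t0 x \<phi>" and \<psi>: "is_solution f t0 y \<psi>"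
    and ab: "t0 \<le> a" "a \<le> b"
    and bound: "\<And>t u. a < t \<Longrightarrow> t < b \<Longrightarrow> u \<bullet> (\<phi> t - \<psi> t) = q (\<phi> t - \<psi> t) \<Longrightarrow>
      (\<And>v. u \<bullet> v \<le> q v) \<Longrightarrow> u \<bullet> (f t (\<phi> t) - f t (\<psi> t)) \<le> c * q (\<phi> t - \<psi> t)"
  shows "q (\<phi> b - \<psi> b) \<le> exp (c * (b - a)) * q (\<phi> a - \<psi> a)"
proof -
  obtain D where D: "\<And>T. finite (D \<inter> {t0..T})" "continuous_on {t0..} \<phi>"
      "\<And>t. t > t0 \<Longrightarrow> t \<notin> D \<Longrightarrow> (\<phi> has_vector_derivative f t (\<phi> t)) (at t)"
    using \<phi> unfolding is_solution_def by blast
  obtain D' where D': "\<And>T. finite (D' \<inter> {t0..T})" "continuous_on {t0..} \<psi>"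
      "\<And>t. t > t0 \<Longrightarrow> t \<notin> D' \<Longrightarrow> (\<psi> has_vector_derivative f t (\<psi> t)) (at t)"
    using \<psi> unfolding is_solution_def by blast
  show ?thesis
  proof (rule norm_exponential_growth[OF q _ ab(2), where z = "\<lambda>t. \<phi> t - \<psi> t"])
    show "finite (D \<inter> {t0..b} \<union> D' \<inter> {t0..b})" using D(1) D'(1) by blast
    have "{a..b} \<subseteq> {t0..}" using ab by auto
    then show "continuous_on {a..b} (\<lambda>t. \<phi> t - \<psi> t)"
      using D(2) D'(2) by (intro continuous_on_diff) (auto intro: continuous_on_subset)
    fix t assume t: "a < t" "t < b"
    show "((\<lambda>t. \<phi> t - \<psi> t) has_vector_derivative f t (\<phi> t) - f t (\<psi> t)) (at t)"
      if "t \<notin> D \<inter> {t0..b} \<union> D' \<inter> {t0..b}"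
      using that t ab by (intro has_vector_derivative_diff D(3) D'(3)) auto
    show "u \<bullet> (f t (\<phi> t) - f t (\<psi> t)) \<le> c * q (\<phi> t - \<psi> t)"
      if "u \<bullet> (\<phi> t - \<psi> t) = q (\<phi> t - \<psi> t)" "\<And>v. u \<bullet> v \<le> q v" for u
      using bound[OF t that] .
  qed
qed

text \<open>The Gronwall estimate, obtained from the Euclidean norm: a subgradient tested on the
  velocity difference is at most the norm of that difference.\<close>

lemma solutions_growth_lipschitz:
  assumes \<phi>: "is_solution f t0 x \<phi>" and \<psi>: "is_solution f t0 y \<psi>" and b: "t0 \<le> b"
    and lip: "\<And>t. t0 < t \<Longrightarrow> t < b \<Longrightarrow> L-lipschitz_on S (f t)"
    and mem: "\<And>t. t0 < t \<Longrightarrow> t < b \<Longrightarrow> \<phi> t \<in> S \<and> \<psi> t \<in> S"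
  shows "norm (\<phi> b - \<psi> b) \<le> exp (L * (b - t0)) * norm (x - y)"
proof -
  have "norm (\<phi> b - \<psi> b) \<le> exp (L * (b - t0)) * norm (\<phi> t0 - \<psi> t0)"
  proof (rule solutions_growth[OF norm_on_UNIV_norm \<phi> \<psi> order_refl b])
    fix t and u :: 'a assume t: "t0 < t" "t < b" and u: "\<And>v. u \<bullet> v \<le> norm v"
    have "u \<bullet> (f t (\<phi> t) - f t (\<psi> t)) \<le> norm (f t (\<phi> t) - f t (\<psi> t))" by (rule u)
    also have "\<dots> \<le> L * norm (\<phi> t - \<psi> t)"
      using lipschitz_onD[OF lip[OF t]] mem[OF t] by (simp add: dist_norm)
    finally show "u \<bullet> (f t (\<phi> t) - f t (\<psi> t)) \<le> L * norm (\<phi> t - \<psi> t)" .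
  qed
  then show ?thesis using \<phi> \<psi> by (simp add: is_solution_def)
qed

lemma continuous_on_Icc_norm_bounded:
  fixes \<phi> :: "real \<Rightarrow> 'a::real_normed_vector"
  assumes "continuous_on {t0..} \<phi>"
  obtains R where "R > 0" "\<And>t. t \<in> {t0..T} \<Longrightarrow> norm (\<phi> t) \<le> R"
proof -
  have "compact (\<phi> ` {t0..T})"
    by (intro compact_continuous_image continuous_on_subset[OF assms]) auto
  then obtain R where "R > 0" "\<forall>x\<in>\<phi> ` {t0..T}. norm x \<le> R"
    using compact_imp_bounded bounded_pos by blast
  then show ?thesis by (intro that) auto
qed

section \<open>Uniqueness of solutions and their dependence on initial states\<close>

locale lipschitz_forward_complete =
  fixes f :: "real \<Rightarrow> 'a::euclidean_space \<Rightarrow> 'a" and t0 :: real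
  assumes locally_lipschitz: "\<And>T r. \<exists>L. \<forall>t\<in>{t0..T}. L-lipschitz_on (cball 0 r) (f t)"
    and complete: "forward_complete f t0"
begin

text \<open>On a compact time interval both solutions stay in one ball with a uniform Lipschitz
  constant, and the Gronwall estimate starts from distance zero.\<close>

lemma solution_unique:
  assumes "is_solution f t0 x \<phi>" "is_solution f t0 x \<psi>" "t0 \<le> t"
  shows "\<phi> t = \<psi> t"
proof -
  obtain R where R: "\<And>s. s \<in> {t0..t} \<Longrightarrow> norm (\<phi> s) \<le> R"
    using continuous_on_Icc_norm_bounded assms(1) unfolding is_solution_def by metis
  obtain R' where R': "\<And>s. s \<in> {t0..t} \<Longrightarrow> norm (\<psi> s) \<le> R'"
    using continuous_on_Icc_norm_bounded assms(2) unfolding is_solution_def by metis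
  obtain L where L: "\<And>s. s \<in> {t0..t} \<Longrightarrow> L-lipschitz_on (cball 0 (max R R')) (f s)"
    using locally_lipschitz by metis
  have "norm (\<phi> t - \<psi> t) \<le> exp (L * (t - t0)) * norm (x - x)"
  proof (rule solutions_growth_lipschitz[OF assms, of L "cball 0 (max R R')"])
    fix s assume "t0 < s" "s < t"
    then show "L-lipschitz_on (cball 0 (max R R')) (f s)"
        "\<phi> s \<in> cball 0 (max R R') \<and> \<psi> s \<in> cball 0 (max R R')"
      using L[of s] R[of s] R'[of s] by (auto simp: le_max_iff_disj)
  qed
  then show ?thesis by simp
qed

lemma sol_eqI:
  assumes "is_solution f t0 x \<phi>" "t0 \<le> t"
  shows "sol f t t0 x = \<phi> t"
  unfolding sol_def
proof (rule the_equality)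
  fix y assume "\<exists>\<psi>. is_solution f t0 x \<psi> \<and> \<psi> t = y"
  then obtain \<psi> where "is_solution f t0 x \<psi>" "\<psi> t = y" by blast
  then show "y = \<phi> t" using solution_unique[OF assms(1)] assms(2) by metis
qed (use assms in blast)

lemma is_solution_sol: "is_solution f t0 x (\<lambda>t. sol f t t0 x)"
proof -
  obtain \<phi> where \<phi>: "is_solution f t0 x \<phi>"
    using complete unfolding forward_complete_def by blast
  obtain D where D: "\<And>T. finite (D \<inter> {t0..T})" "continuous_on {t0..} \<phi>"
      "\<And>t. t > t0 \<Longrightarrow> t \<notin> D \<Longrightarrow> (\<phi> has_vector_derivative f t (\<phi> t)) (at t)"
    using \<phi> unfolding is_solution_def by blast
  note eq = sol_eqI[OF \<phi>]
  show ?thesis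
    unfolding is_solution_def
  proof (intro conjI exI[of _ D] allI impI)
    show "sol f t0 t0 x = x" using eq[of t0] \<phi> by (simp add: is_solution_def)
    show "continuous_on {t0..} (\<lambda>t. sol f t t0 x)"
      using D(2) continuous_on_cong[OF refl, of "{t0..}" "\<lambda>t. sol f t t0 x" \<phi>] eq by auto
    fix t assume t: "t0 < t" "t \<notin> D"
    have "((\<lambda>t. sol f t t0 x) has_vector_derivative f t (\<phi> t)) (at t)"
      \<comment> \<open>The two functions agree only from \<open>t0\<close> on, so the derivative is
        transferred within the open half-line.\<close>
      by (rule has_vector_derivative_transform_within_open[OF D(3)[OF t], of "{t0<..}"])
         (use t eq in auto)
    then show "((\<lambda>t. sol f t t0 x) has_vector_derivative f t (sol f t t0 x)) (at t)"
      using eq[of t] t by simp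
  qed (use D(1) in blast)
qed

text \<open>A solution starting near \<open>x\<close> cannot leave the unit tube around the solution from \<open>x\<close>:
  up to the first time at which it would, the Lipschitz estimate inside the tube applies.\<close>

lemma locally_bounded_sol:
  obtains \<delta> R where "\<delta> > 0"
    "\<And>y t. norm (x - y) < \<delta> \<Longrightarrow> t \<in> {t0..T} \<Longrightarrow> norm (sol f t t0 y) \<le> R"
proof -
  obtain R where R: "\<And>t. t \<in> {t0..T} \<Longrightarrow> norm (sol f t t0 x) \<le> R"
    using continuous_on_Icc_norm_bounded is_solution_sol[of x] unfolding is_solution_def by metis
  obtain L where L: "\<And>s. s \<in> {t0..T} \<Longrightarrow> L-lipschitz_on (cball 0 (R + 1)) (f s)"
    using locally_lipschitz by metis
  \<comment> \<open>The reciprocal of the largest possible growth factor on the time interval; the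
    absolute values cover a negative \<open>L\<close> and a \<open>T\<close> before
    \<open>t0\<close>.\<close>
  define \<delta> where "\<delta> = exp (- (\<bar>L\<bar> * \<bar>T - t0\<bar>))"
  have tube: "norm (sol f t t0 x - sol f t t0 y) < 1"
    if y: "norm (x - y) < \<delta>" and t: "t \<in> {t0..T}" for y t
  proof (rule ccontr)
    assume "\<not> norm (sol f t t0 x - sol f t t0 y) < 1"
    define g where "g s = norm (sol f s t0 x - sol f s t0 y)" for s
    define S where "S = {s \<in> {t0..t}. g s \<in> {1..}}"
    have "continuous_on {t0..} g"
      unfolding g_def using is_solution_sol unfolding is_solution_def
      by (intro continuous_intros) auto
    then have "continuous_on {t0..t} g" by (rule continuous_on_subset) auto
    then have "closed S"
      unfolding S_def by (intro continuous_closed_preimage[unfolded Int_def vimage_def mem_Collect_eq, simplified])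
         auto
    then have "compact S"
      unfolding S_def using compact_Icc[of t0 t] by (metis (no_types, lifting) compact_Int_closed Int_absorb1 mem_Collect_eq subsetI)
    moreover have "t \<in> S"
      using \<open>\<not> _ < 1\<close> t by (auto simp: S_def g_def)
    \<comment> \<open>The first time at which the distance reaches 1; before it both solutions lie
      in the ball of radius \<open>R + 1\<close>.\<close>
    ultimately obtain s where s: "s \<in> S" "\<And>r. r \<in> S \<Longrightarrow> s \<le> r"
      using compact_attains_inf[of S] by blast
    have s': "t0 \<le> s" "s \<le> t" "1 \<le> g s" using s(1) by (auto simp: S_def)
    have "g s \<le> exp (L * (s - t0)) * norm (x - y)"
      unfolding g_def
    proof (rule solutions_growth_lipschitz[OF is_solution_sol is_solution_sol s'(1),
          of L "cball 0 (R + 1)"])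
      fix r assume r: "t0 < r" "r < s"
      then have "r \<notin> S" using s(2) by force
      then have "g r < 1" using r s' by (auto simp: S_def)
      moreover have "norm (sol f r t0 x) \<le> R" using R r s' t by auto
      ultimately show "sol f r t0 x \<in> cball 0 (R + 1) \<and> sol f r t0 y \<in> cball 0 (R + 1)"
        using norm_triangle_ineq2[of "sol f r t0 y" "sol f r t0 x"]
        by (auto simp: g_def norm_minus_commute)
      show "L-lipschitz_on (cball 0 (R + 1)) (f r)" using L r s' t by auto
    qed
    also have "\<dots> \<le> exp (\<bar>L\<bar> * \<bar>T - t0\<bar>) * norm (x - y)"
      using s' t by (intro mult_right_mono) (auto intro!: mult_mono)
    also have "\<dots> < exp (\<bar>L\<bar> * \<bar>T - t0\<bar>) * \<delta>" using y by simp
    also have "\<dots> = 1" by (simp add: \<delta>_def exp_minus)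
    finally show False using s'(3) by simp
  qed
  have "norm (sol f t t0 y) \<le> R + 1" if "norm (x - y) < \<delta>" "t \<in> {t0..T}" for y t
    using tube[OF that] R[OF that(2)] norm_triangle_ineq2[of "sol f t t0 y" "sol f t t0 x"]
    by (simp add: norm_minus_commute)
  then show ?thesis by (intro that[of \<delta> "R + 1"]) (auto simp: \<delta>_def)
qed

text \<open>Finitely many of the balls from the local bound cover \<open>K\<close>; the sum of the
  absolute values of their bounds serves as a common bound.\<close>

lemma bounded_sol:
  assumes "compact K"
  obtains R where "\<And>x t. x \<in> K \<Longrightarrow> t \<in> {t0..T} \<Longrightarrow> norm (sol f t t0 x) \<le> R"
proof -
  have "\<forall>x. \<exists>\<delta> R. \<delta> > 0 \<and> (\<forall>y t. norm (x - y) < \<delta> \<longrightarrow> t \<in> {t0..T} \<longrightarrow> norm (sol f t t0 y) \<le> R)"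
    using locally_bounded_sol by metis
  then obtain \<delta> R where *: "\<And>x. \<delta> x > 0"
      "\<And>x y t. norm (x - y) < \<delta> x \<Longrightarrow> t \<in> {t0..T} \<Longrightarrow> norm (sol f t t0 y) \<le> R x"
    by metis
  have "K \<subseteq> (\<Union>x\<in>K. ball x (\<delta> x))" using *(1) by force
  then obtain X where X: "X \<subseteq> K" "finite X" "K \<subseteq> (\<Union>x\<in>X. ball x (\<delta> x))"
    using compactE_image[OF assms, of K "\<lambda>x. ball x (\<delta> x)"] by blast
  have "norm (sol f t t0 y) \<le> (\<Sum>x\<in>X. \<bar>R x\<bar>)" if y: "y \<in> K" "t \<in> {t0..T}" for y t
  proof -
    obtain x where x: "x \<in> X" "y \<in> ball x (\<delta> x)" using X(3) y by blast
    then have "norm (sol f t t0 y) \<le> \<bar>R x\<bar>"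
      using *(2)[of x y t] y by (force simp: dist_norm)
    also have "\<dots> \<le> (\<Sum>x\<in>X. \<bar>R x\<bar>)" using x X(2) by (intro member_le_sum) auto
    finally show ?thesis .
  qed
  then show ?thesis by (rule that)
qed

text \<open>All trajectories from \<open>K\<close> stay in one ball up to time \<open>T\<close>, so
  one Lipschitz constant works for every pair. This controls the times before the asymptotic
  estimate on the matrix measure takes effect.\<close>

lemma lipschitz_sol:
  assumes "compact K"
  obtains C where "C > 0" "\<And>x y t. x \<in> K \<Longrightarrow> y \<in> K \<Longrightarrow> t \<in> {t0..T} \<Longrightarrow>
    norm (sol f t t0 x - sol f t t0 y) \<le> C * norm (x - y)"
proof -
  obtain R where R: "\<And>x t. x \<in> K \<Longrightarrow> t \<in> {t0..T} \<Longrightarrow> norm (sol f t t0 x) \<le> R"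
    using bounded_sol[OF assms] by blast
  obtain L where L: "\<And>s. s \<in> {t0..T} \<Longrightarrow> L-lipschitz_on (cball 0 R) (f s)"
    using locally_lipschitz by metis
  have "norm (sol f t t0 x - sol f t t0 y) \<le> exp (\<bar>L\<bar> * \<bar>T - t0\<bar>) * norm (x - y)"
    if xy: "x \<in> K" "y \<in> K" and t: "t \<in> {t0..T}" for x y t
  proof -
    have "norm (sol f t t0 x - sol f t t0 y) \<le> exp (L * (t - t0)) * norm (x - y)"
      by (rule solutions_growth_lipschitz[OF is_solution_sol is_solution_sol, of _ L "cball 0 R"])
         (use t L R xy in auto)
    also have "\<dots> \<le> exp (\<bar>L\<bar> * \<bar>T - t0\<bar>) * norm (x - y)"
      using t by (intro mult_right_mono) (auto intro!: mult_mono)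
    finally show ?thesis .
  qed
  then show ?thesis by (intro that[of "exp (\<bar>L\<bar> * \<bar>T - t0\<bar>)"]) auto
qed

end

section \<open>Entropy of flows with exponentially bounded separation\<close>

text \<open>One point of \<open>K\<close> is chosen in each nonempty cell of a cubic grid of mesh \<open>s\<close>.\<close>

lemma grid_covering:
  fixes K :: "(real ^ 'n::finite) set"
  assumes "K \<subseteq> cball 0 R" "0 \<le> R" "0 < s"
  obtains E where "finite E" "E \<subseteq> K"
    "\<And>y. y \<in> K \<Longrightarrow> \<exists>x\<in>E. norm (y - x) \<le> real CARD('n) * s"
    "real (card E) \<le> (2 * R / s + 3) ^ CARD('n)"
proof -
  define cell where "cell x k = \<lfloor>x $ k / s\<rfloor>" for x :: "real ^ 'n" and k
  \<comment> \<open>Each cell index lies between \<open>-M\<close> and \<open>M\<close>. These are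
    \<open>2 * M + 1\<close> values per coordinate, and rounding up costs at most 2, whence the 3 in
    the count.\<close>
  define M where "M = \<lceil>R / s\<rceil>"
  define E where "E = inv_into K cell ` cell ` K"
  have cells: "cell ` K \<subseteq> UNIV \<rightarrow>\<^sub>E {-M..M}"
  proof clarify
    fix x assume x: "x \<in> K"
    show "cell x \<in> UNIV \<rightarrow>\<^sub>E {-M..M}"
    proof (rule PiE_I)
      fix k
      have "\<bar>x $ k\<bar> \<le> R"
        using assms(1) x component_le_norm_cart[of x k] by force
      then have "\<bar>x $ k / s\<bar> \<le> R / s"
        using assms(3) by (simp add: divide_right_mono)
      then have "- (R / s) \<le> x $ k / s" "x $ k / s \<le> R / s" by linarith+
      then show "cell x k \<in> {-M..M}"
        unfolding cell_def M_def atLeastAtMost_iff by linarith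
    qed simp
  qed
  have fin: "finite (UNIV \<rightarrow>\<^sub>E {-M..M} :: ('n \<Rightarrow> int) set)" by (intro finite_PiE) auto
  then have finc: "finite (cell ` K)" using cells finite_subset by blast
  have M: "0 \<le> M" "real_of_int M \<le> R / s + 1"
    using assms(2,3) unfolding M_def by (auto intro: ceiling_mono[of 0, simplified])
  have "card E \<le> card (cell ` K)" unfolding E_def by (rule card_image_le[OF finc])
  also have "\<dots> \<le> card (UNIV \<rightarrow>\<^sub>E {-M..M} :: ('n \<Rightarrow> int) set)" by (rule card_mono[OF fin cells])
  also have "\<dots> = nat (2 * M + 1) ^ CARD('n)"
    by (subst card_PiE) (auto simp: algebra_simps)
  finally have "real (card E) \<le> real (nat (2 * M + 1) ^ CARD('n))" by (rule of_nat_mono)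
  also have "\<dots> \<le> (2 * R / s + 3) ^ CARD('n)"
    unfolding of_nat_power using M by (intro power_mono) auto
  finally have card: "real (card E) \<le> (2 * R / s + 3) ^ CARD('n)" .
  have near: "\<exists>x\<in>E. norm (y - x) \<le> real CARD('n) * s" if y: "y \<in> K" for y
  proof
    let ?x = "inv_into K cell (cell y)"
    show "?x \<in> E" unfolding E_def using y by blast
    have eq: "cell ?x = cell y" using y by (intro f_inv_into_f) auto
    have "\<bar>(y - ?x) $ k\<bar> \<le> s" for k
    proof -
      have "\<lfloor>?x $ k / s\<rfloor> = \<lfloor>y $ k / s\<rfloor>"
        using fun_cong[OF eq, of k] by (simp add: cell_def)
      then have "\<bar>y $ k / s - ?x $ k / s\<bar> \<le> 1" by linarith
      then show ?thesis
        using assms(3) by (simp add: diff_divide_distrib[symmetric])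
    qed
    then have "(\<Sum>k\<in>UNIV. \<bar>(y - ?x) $ k\<bar>) \<le> (\<Sum>k\<in>(UNIV :: 'n set). s)" by (rule sum_mono)
    then show "norm (y - ?x) \<le> real CARD('n) * s"
      using norm_le_l1_cart[of "y - ?x"] by simp
  qed
  have "E \<subseteq> K" unfolding E_def by (auto intro: inv_into_into)
  then show ?thesis using finc card near by (intro that[of E]) (auto simp: E_def)
qed

lemma log_enat_mono: "k \<le> l \<Longrightarrow> log_enat k \<le> log_enat l"
proof (cases k; cases l)
  fix i j assume *: "k \<le> l" "k = enat i" "l = enat j"
  show ?thesis
  \<comment> \<open>Here \<open>ln 0 = 0\<close> makes the logarithm monotone also at cardinality
    zero.\<close>
  proof (cases "i = 0")
    case True
    then show ?thesis using * by (cases "j = 0") (auto simp: log_enat_def)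
  qed (use * in \<open>auto simp: log_enat_def\<close>)
qed (auto simp: log_enat_def)

text \<open>Smaller radii need larger spanning sets, so the growth rate is antitone in the radius.
  Its limit at 0 from the right therefore exists and equals the supremum over all positive
  radii.\<close>

lemma topological_entropy_le:
  assumes bound: "\<And>\<epsilon>. \<epsilon> > 0 \<Longrightarrow>
    Limsup at_top (\<lambda>T::real. log_enat (spanning_number p f t0 \<epsilon> T K) / ereal T) \<le> B"
  shows "topological_entropy p f t0 K \<le> B"
proof -
  define F where "F \<epsilon> = Limsup at_top (\<lambda>T::real. log_enat (spanning_number p f t0 \<epsilon> T K) / ereal T)"
    for \<epsilon> :: real
  have anti: "F \<epsilon>' \<le> F \<epsilon>" if "\<epsilon> \<le> \<epsilon>'" for \<epsilon> \<epsilon>' :: real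
  proof -
    have "bowen_ball p f t0 x \<epsilon> T \<subseteq> bowen_ball p f t0 x \<epsilon>' T" for x T
      unfolding bowen_ball_def using that by (intro Collect_mono impI) (rule less_le_trans)
    then have "spanning p f t0 \<epsilon> T K E \<Longrightarrow> spanning p f t0 \<epsilon>' T K E" for T E
      unfolding spanning_def by blast
    then have "spanning_number p f t0 \<epsilon>' T K \<le> spanning_number p f t0 \<epsilon> T K" for T
      unfolding spanning_number_def by (intro INF_superset_mono) auto
    then show ?thesis
      unfolding F_def
      by (intro Limsup_mono eventually_mono[OF eventually_gt_at_top[of 0]] ereal_divide_right_mono log_enat_mono)
         auto
  qed
  have "(F \<longlongrightarrow> (SUP \<epsilon>\<in>{0<..}. F \<epsilon>)) (at_right 0)"
  proof (rule order_tendstoI)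
    fix a assume "a < (SUP \<epsilon>\<in>{0<..}. F \<epsilon>)"
    then obtain \<epsilon> where "\<epsilon> > 0" "a < F \<epsilon>" by (auto simp: less_SUP_iff)
    then show "eventually (\<lambda>\<epsilon>. a < F \<epsilon>) (at_right 0)"
      unfolding eventually_at_right_field using anti by (meson less_imp_le less_le_trans)
  next
    fix a assume "(SUP \<epsilon>\<in>{0<..}. F \<epsilon>) < a"
    then have "F \<epsilon> < a" if "\<epsilon> > 0" for \<epsilon>
      using SUP_upper[of \<epsilon> "{0<..}" F] that by auto
    then show "eventually (\<lambda>\<epsilon>. F \<epsilon> < a) (at_right 0)"
      by (rule eventually_mono[OF eventually_at_right_less])
  qed
  then have "topological_entropy p f t0 K = (SUP \<epsilon>\<in>{0<..}. F \<epsilon>)"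
    unfolding topological_entropy_def F_def[symmetric]
    by (rule tendsto_Lim[OF trivial_limit_at_right_real])
  also have "\<dots> \<le> B" using bound unfolding F_def by (intro SUP_least) auto
  finally show ?thesis .
qed

text \<open>A grid fine enough to compensate the worst separation up to time \<open>T\<close> yields
  a spanning set of size at most a constant times \<open>exp (c * T)\<close> raised to the
  dimension; the constant vanishes after taking logarithms and dividing by \<open>T\<close>.\<close>

lemma entropy_le_of_exponential_separation:
  fixes f :: "real \<Rightarrow> real ^ 'n::finite \<Rightarrow> real ^ 'n"
  assumes "compact K" "c > 0" "C > 0"
    and sep: "\<And>x y T t. x \<in> K \<Longrightarrow> y \<in> K \<Longrightarrow> t \<in> {t0..t0 + T} \<Longrightarrow>
      p (sol f t t0 y - sol f t t0 x) \<le> C * exp (c * T) * norm (y - x)"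
  shows "topological_entropy p f t0 K \<le> ereal (real CARD('n) * c)"
proof (rule topological_entropy_le)
  fix \<epsilon> :: real assume \<epsilon>: "\<epsilon> > 0"
  define n where "n = real CARD('n)"
  have n: "n > 0" by (simp add: n_def)
  obtain R where R: "R > 0" "K \<subseteq> cball 0 R"
    using compact_imp_bounded[OF assms(1)] unfolding bounded_pos by (force simp: subset_iff)
  \<comment> \<open>Chosen so that \<open>2 * R / s = \<kappa> * exp (c * T)\<close> for the mesh
    \<open>s\<close> used below.\<close>
  define \<kappa> where "\<kappa> = 4 * R * n * C / \<epsilon>"
  have \<kappa>: "\<kappa> > 0" using R n assms(3) \<epsilon> by (simp add: \<kappa>_def)
  have "log_enat (spanning_number p f t0 \<epsilon> T K) / ereal T \<le> ereal (n * ln (\<kappa> + 3) / T + n * c)"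
    if T: "T > 0" for T
  proof -
    \<comment> \<open>With this mesh, points at distance at most \<open>n * s\<close> separate by at
      most half of \<open>\<epsilon>\<close>, which leaves the strict inequality of the Bowen ball
      intact after taking the supremum.\<close>
    define s where "s = \<epsilon> / (2 * n * C * exp (c * T))"
    have s: "s > 0" using \<epsilon> n assms(3) by (simp add: s_def)
    obtain E where E: "finite E" "E \<subseteq> K" "\<And>y. y \<in> K \<Longrightarrow> \<exists>x\<in>E. norm (y - x) \<le> n * s"
        "real (card E) \<le> (2 * R / s + 3) ^ CARD('n)"
      using grid_covering[OF R(2) _ s] R(1) unfolding n_def by force
    have "spanning p f t0 \<epsilon> T K E"
      unfolding spanning_def
    proof (intro conjI subsetI E(2)[THEN subsetD])
      fix y assume y: "y \<in> K"
      then obtain x where x: "x \<in> E" "norm (y - x) \<le> n * s" using E(3) by blast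
      have "(SUP t\<in>{t0..t0 + T}. p (sol f t t0 y - sol f t t0 x)) \<le> C * exp (c * T) * norm (y - x)"
        using T x(1) y E(2) by (intro cSUP_least sep) auto
      also have "\<dots> \<le> C * exp (c * T) * (n * s)"
        using x(2) assms(3) by (intro mult_left_mono) auto
      also have "\<dots> < \<epsilon>" using n assms(3) \<epsilon> by (simp add: s_def)
      finally show "y \<in> (\<Union>x\<in>E. bowen_ball p f t0 x \<epsilon> T)"
        unfolding bowen_ball_def using x(1) by blast
    qed
    then have "spanning_number p f t0 \<epsilon> T K \<le> enat (card E)"
      unfolding spanning_number_def using E(1) by (intro INF_lower) auto
    then have "log_enat (spanning_number p f t0 \<epsilon> T K) \<le> ereal (ln (real (card E)))"
      using log_enat_mono[of _ "enat (card E)"] by (simp add: log_enat_def)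
    also have "ln (real (card E)) \<le> n * ln (\<kappa> + 3) + n * c * T"
    proof -
      have "2 * R / s = \<kappa> * exp (c * T)"
        using n assms(3) \<epsilon> by (simp add: s_def \<kappa>_def field_simps)
      moreover have "1 \<le> exp (c * T)" using assms(2) T by simp
      ultimately have "2 * R / s + 3 \<le> (\<kappa> + 3) * exp (c * T)" by (simp add: algebra_simps)
      moreover have "0 \<le> 2 * R / s + 3" using R(1) s by simp
      ultimately have le: "real (card E) \<le> ((\<kappa> + 3) * exp (c * T)) ^ CARD('n)"
        using E(4) power_mono order_trans by blast
      have "1 * 1 \<le> (\<kappa> + 3) * exp (c * T)"
        using \<kappa> \<open>1 \<le> exp (c * T)\<close> by (intro mult_mono) auto
      then have ge1: "1 \<le> ((\<kappa> + 3) * exp (c * T)) ^ CARD('n)" by (simp add: one_le_power)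
      have "ln (real (card E)) \<le> ln (((\<kappa> + 3) * exp (c * T)) ^ CARD('n))"
        \<comment> \<open>An empty \<open>K\<close> gives an empty \<open>E\<close>; then
          \<open>ln 0 = 0\<close> lies below the logarithm of a number that is at least 1.\<close>
        using le ge1 by (cases "card E = 0") auto
      also have "\<dots> = n * (ln (\<kappa> + 3) + c * T)"
        using \<kappa> by (simp add: ln_realpow ln_mult n_def)
      finally show ?thesis by (simp add: algebra_simps)
    qed
    finally have "log_enat (spanning_number p f t0 \<epsilon> T K) / ereal T
        \<le> ereal (n * ln (\<kappa> + 3) + n * c * T) / ereal T"
      using T by (intro ereal_divide_right_mono) auto
    also have "\<dots> = ereal (n * ln (\<kappa> + 3) / T + n * c)"
      using T by (simp add: add_divide_distrib)
    finally show ?thesis .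
  qed
  then have "Limsup at_top (\<lambda>T. log_enat (spanning_number p f t0 \<epsilon> T K) / ereal T)
      \<le> Limsup at_top (\<lambda>T. ereal (n * ln (\<kappa> + 3) / T + n * c))"
    by (intro Limsup_mono eventually_mono[OF eventually_gt_at_top[of 0]]) auto
  also have "\<dots> = ereal (n * c)"
  proof (rule lim_imp_Limsup)
    have "((\<lambda>T. n * ln (\<kappa> + 3) / T + n * c) \<longlongrightarrow> 0 + n * c) at_top"
      by (intro tendsto_add tendsto_const tendsto_divide_0[OF tendsto_const]
          filterlim_at_top_imp_at_infinity filterlim_ident)
    then show "((\<lambda>T. ereal (n * ln (\<kappa> + 3) / T + n * c)) \<longlongrightarrow> ereal (n * c)) at_top"
      by simp
  qed simp
  finally show "Limsup at_top (\<lambda>T. log_enat (spanning_number p f t0 \<epsilon> T K) / ereal T)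
      \<le> ereal (real CARD('n) * c)" by (simp add: n_def)
qed

section \<open>From the matrix measure bound to the entropy bound\<close>

theorem corollary2:
  fixes f :: "real \<Rightarrow> real ^ 'n::finite \<Rightarrow> real ^ 'n"
    and b :: "'n \<Rightarrow> 'm::finite"
    and t0 :: real
    and K :: "(real ^ 'n) set"
    and lnorm :: "'m \<Rightarrow> real ^ 'n \<Rightarrow> real"
    and nnorm :: "real ^ 'm \<Rightarrow> real"
    and p :: "real ^ 'n \<Rightarrow> real"
    and mu_hat :: ereal
  assumes "CARD('m) \<ge> 2"
    and "surj b"
    and "piecewise_continuous_in_time t0 f"
    and "continuously_differentiable_in_state t0 f"
    and "forward_complete f t0"
    and "compact K" and "interior K \<noteq> {}"
    and "\<And>i. norm_on (block_space b i) (lnorm i)"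
    and "monotone_norm nnorm"
    and "norm_on UNIV p"
  defines "mu_hat \<equiv> Limsup at_top (\<lambda>t.
      SUP v\<in>convex hull (sol f t t0 ` K).
        ereal (matrix_measure UNIV nnorm (interconnection_matrix b lnorm f t v)))"
  shows "topological_entropy p f t0 K \<le> ereal (real CARD('n)) * max mu_hat 0"
proof -
  interpret composite_norm b lnorm nnorm
    using assms(2,8,9) by unfold_locales
  interpret lipschitz_forward_complete f t0
    using assms(4,5) unfolding continuously_differentiable_in_state_def by unfold_locales auto
  have diff: "f t differentiable (at v)" if "t0 \<le> t" for t v
    using assms(4) that unfolding continuously_differentiable_in_state_def by blast
  obtain Cp where Cp: "Cp > 0" "\<And>v. p v \<le> Cp * norm v"
    by (rule norm_on_upper[OF assms(10) subspace_UNIV]) simp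
  obtain Cg where Cg: "Cg > 0" "\<And>v. gnorm v \<le> Cg * norm v"
    by (rule norm_on_upper[OF norm_on_gnorm subspace_UNIV]) simp
  obtain Cn where Cn: "Cn > 0" "\<And>v. norm v \<le> Cn * gnorm v"
    by (rule norm_on_lower[OF norm_on_gnorm subspace_UNIV]) simp
  \<comment> \<open>It suffices to treat every positive real \<open>c\<close> above
    \<open>mu_hat\<close>. Positivity lets \<open>exp (c * T)\<close> dominate the growth factor at
    all earlier times as well.\<close>
  have main: "topological_entropy p f t0 K \<le> ereal (real CARD('n) * c)"
    if c: "0 < c" "mu_hat < ereal c" for c
  proof -
    have "eventually (\<lambda>t. t0 \<le> t \<and> (SUP v\<in>convex hull (sol f t t0 ` K).
        ereal (matrix_measure UNIV nnorm (interconnection_matrix b lnorm f t v))) < ereal c) at_top"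
      using Limsup_lessD[OF c(2)[unfolded mu_hat_def]] by (intro eventually_conj eventually_ge_at_top)
    \<comment> \<open>From \<open>T1\<close> on, the matrix measure stays below \<open>c\<close> on
      the whole convex hull; before \<open>T1\<close> only the Lipschitz estimate is
      available.\<close>
    then obtain T1 where T1: "\<And>t. T1 \<le> t \<Longrightarrow> t0 \<le> t \<and> (SUP v\<in>convex hull (sol f t t0 ` K).
        ereal (matrix_measure UNIV nnorm (interconnection_matrix b lnorm f t v))) < ereal c"
      unfolding eventually_at_top_linorder by blast
    have mm: "matrix_measure UNIV nnorm (interconnection_matrix b lnorm f t v) < c"
      if "T1 \<le> t" "v \<in> convex hull (sol f t t0 ` K)" for t v
      using T1[OF that(1)] SUP_upper[OF that(2), of
          "\<lambda>v. ereal (matrix_measure UNIV nnorm (interconnection_matrix b lnorm f t v))"]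
      by (meson ereal_less_le less_ereal.simps(1) order_le_less_trans)
    obtain CL where CL: "CL > 0" "\<And>x y t. x \<in> K \<Longrightarrow> y \<in> K \<Longrightarrow> t \<in> {t0..T1} \<Longrightarrow>
        norm (sol f t t0 x - sol f t t0 y) \<le> CL * norm (x - y)"
      using lipschitz_sol[OF assms(6)] by blast
    have late: "gnorm (sol f t t0 x - sol f t t0 y) \<le> exp (c * (t - T1)) * gnorm (sol f T1 t0 x - sol f T1 t0 y)"
      if xy: "x \<in> K" "y \<in> K" and t: "T1 \<le> t" for x y t
    proof (rule solutions_growth[OF norm_on_gnorm is_solution_sol is_solution_sol _ t])
      show "t0 \<le> T1" using T1 by blast
      fix s u assume s: "T1 < s" "s < t"
        and u: "u \<bullet> (sol f s t0 x - sol f s t0 y) = gnorm (sol f s t0 x - sol f s t0 y)"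
          "\<And>v. u \<bullet> v \<le> gnorm v"
      \<comment> \<open>The mean value point lies somewhere on the segment between two states, which
        is why the estimate is needed on the convex hull and not only on the image of
        \<open>K\<close>.\<close>
      have "closed_segment (sol f s t0 y) (sol f s t0 x) \<subseteq> convex hull (sol f s t0 ` K)"
        using xy by (intro closed_segment_subset convex_convex_hull) (auto intro: hull_inc)
      then show "u \<bullet> (f s (sol f s t0 x) - f s (sol f s t0 y)) \<le> c * gnorm (sol f s t0 x - sol f s t0 y)"
        using s T1[of s] by (intro subgradient_increment_bound[OF u diff mm]) auto
    qed
    \<comment> \<open>\<open>Cn * Cg\<close> pays for passing to \<open>gnorm\<close> and back,
      \<open>CL\<close> for the growth up to \<open>T1\<close>, and \<open>Cp\<close> for passing to
      \<open>p\<close>; the summand 1 covers times up to \<open>T1\<close>, where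
      \<open>gnorm\<close> does not enter.\<close>
    define C where "C = Cp * CL * (1 + Cn * Cg)"
    show ?thesis
    proof (rule entropy_le_of_exponential_separation[OF assms(6) c(1), of C])
      show "C > 0" using Cp Cg Cn CL by (simp add: C_def add_pos_pos)
      fix x y T t assume xy: "x \<in> K" "y \<in> K" and t: "t \<in> {t0..t0 + T}"
      have "norm (sol f t t0 y - sol f t t0 x) \<le> exp (c * T) * (CL * (1 + Cn * Cg) * norm (y - x))"
      proof (cases "t \<le> T1")
        case True
        have "norm (sol f t t0 y - sol f t t0 x) \<le> 1 * (CL * 1 * norm (y - x))"
          using CL(2)[OF xy(2,1), of t] True t by simp
        also have "\<dots> \<le> exp (c * T) * (CL * (1 + Cn * Cg) * norm (y - x))"
          using c(1) t CL(1) Cn(1) Cg(1) by (intro mult_mono) auto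
        finally show ?thesis .
      next
        case False
        have "norm (sol f t t0 y - sol f t t0 x) \<le> Cn * gnorm (sol f t t0 y - sol f t t0 x)"
          by (rule Cn)
        also have "\<dots> \<le> Cn * (exp (c * (t - T1)) * gnorm (sol f T1 t0 y - sol f T1 t0 x))"
          using late[OF xy(2,1), of t] False Cn(1) by (intro mult_left_mono) auto
        also have "\<dots> \<le> Cn * (exp (c * T) * (Cg * (CL * norm (y - x))))"
        proof (intro mult_left_mono[OF mult_mono])
          have "t - T1 \<le> T" using t T1[of T1] by auto
          then show "exp (c * (t - T1)) \<le> exp (c * T)" using c(1) by simp
          have "gnorm (sol f T1 t0 y - sol f T1 t0 x) \<le> Cg * norm (sol f T1 t0 y - sol f T1 t0 x)"
            by (rule Cg)
          also have "\<dots> \<le> Cg * (CL * norm (y - x))"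
            using CL(2)[OF xy(2,1), of T1] T1[of T1] Cg(1) by (intro mult_left_mono) auto
          finally show "gnorm (sol f T1 t0 y - sol f T1 t0 x) \<le> Cg * (CL * norm (y - x))" .
        qed (use Cn(1) norm_on_nonneg[OF norm_on_gnorm] in auto)
        also have "\<dots> \<le> exp (c * T) * (CL * (1 + Cn * Cg) * norm (y - x))"
          using CL(1) by (simp add: algebra_simps)
        finally show ?thesis .
      qed
      then have "Cp * norm (sol f t t0 y - sol f t t0 x)
          \<le> Cp * (exp (c * T) * (CL * (1 + Cn * Cg) * norm (y - x)))"
        using Cp(1) by (intro mult_left_mono) auto
      then show "p (sol f t t0 y - sol f t t0 x) \<le> C * exp (c * T) * norm (y - x)"
        using Cp(2)[of "sol f t t0 y - sol f t t0 x"] by (simp add: C_def mult_ac)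
    qed
  qed
  show ?thesis
  proof (cases "max mu_hat 0")
    case (real r)
    then have r: "0 \<le> r" "mu_hat \<le> ereal r"
      by (metis ereal_less_eq(5) max.cobounded2, metis max.cobounded1)
    have "topological_entropy p f t0 K \<le> ereal (real CARD('n) * r) + ereal e" if e: "e > 0" for e
    proof -
      \<comment> \<open>The excess over \<open>r\<close> is multiplied by the dimension in
        \<open>main\<close>, so it is divided by it here.\<close>
      define d where "d = e / real CARD('n)"
      have d: "d > 0" using e by (simp add: d_def)
      have "mu_hat < ereal (r + d)"
        using r(2) d by (meson ereal_less_eq(3) le_less_trans less_add_same_cancel1 less_ereal.simps(1))
      then have "topological_entropy p f t0 K \<le> ereal (real CARD('n) * (r + d))"
        using r(1) d by (intro main) auto
      then show ?thesis by (simp add: d_def distrib_left)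
    qed
    then show ?thesis
      unfolding real by (simp add: ereal_le_epsilon2)
  next
    case PInf
    then show ?thesis by simp
  next
    case MInf
    have "0 \<le> max mu_hat 0" by simp
    with MInf show ?thesis by simp
  qed
qed

end
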